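(* For every $\mu>0$ and every $(x,y)\in\mathcal{H}=H\times H^{-1}$, $$V^{\mu}(x,y)=\inf\left\{ I^{\mu}_{-\infty}(z)\;:\; z\in C((-\infty,0];\mathcal{H}),\ z(0)=(x,y),\ \lim_{t\to-\infty}\left|C_\mu^{-1/2}z(t)\right|_{\mathcal{H}}=0\right\}.$$ (Both sides take values in $[0,+\infty]$, with $\inf\emptyset=+\infty$.)
   Context: **Setting.** Let $\mathcal{O}\subset\mathbb{R}^d$ ($d\ge 1$) be a bounded domain with regular boundary, $H=L^2(\mathcal{O})$, and let $A$ be the realization of the Laplacian in $H$ with Dirichlet boundary conditions. Let $\{e_k\}_{k\in\mathbb{N}}$ be a complete orthonormal basis of $H$ with $Ae_k=-\alpha_k e_k$, $0<\alpha_1\le\alpha_k\le\alpha_{k+1}$. For $\delta\in\mathbb{R}$, $H^\delta$ is the completion of $C_0^\infty(\mathcal{O})$ in the norm $|u|_{H^\delta}^2=\sum_k\alpha_k^\delta\langle u,e_k\rangle_H^2$. Set $\mathcal{H}_\delta=H^\delta\times H^{\delta-1}$ and $\mathcal{H}=\mathcal{H}_0=H\times H^{-1}$. $\Pi_1$ denotes projection onto the first component. Operators diagonal in $\{e_k\}$ are extended to the spaces $H^\delta$ diagonally. **Assumption on $Q$.** $Q$ is a bounded linear operator on $H$, diagonal in the basis $\{e_k\}$, $Qe_k=\lambda_ke_k$, with $\sum_{k}\lambda_k^2/\alpha_k<+\infty$. **Assumption on $F$.** $F:H\to\mathbb{R}$ is of class $C^1$, $F(0)=0$, $F(x)\ge0$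 and $\langle DF(x),x\rangle_H\ge0$ for all $x\in H$, and there is $\kappa\geq 0$ with $|DF(x)-DF(y)|_H\le\kappa|x-y|_H$ for all $x,y\in H$, where $DF(x)\in H$ is the gradient. **Operators.** For $\mu>0$, $A_\mu(u,v)=\left(v,\tfrac1\mu Au-\tfrac1\mu v\right)$ with domain $D(A_\mu)=\mathcal{H}_1$ in $\mathcal{H}$; it generates a $C_0$-semigroup $S_\mu(t)$ on $\mathcal{H}$. $Q_\mu v=\tfrac1\mu(0,Qv)$. Moreover $$C_\mu(u,v)=\tfrac12\left((-A)^{-1}Q^2u,\tfrac1\mu(-A)^{-1}Q^2v\right),\qquad (u,v)\in\mathcal{H},$$ and $C_\mu^{-1/2}$ is the inverse (pseudo-inverse, if $C_\mu^{1/2}$ is not injective) of $C_\mu^{1/2}$, with domain $D(C_\mu^{-1/2})=\mathrm{Im}(C_\mu^{1/2})$. The limit condition in the claim includes that $z(t)\in D(C_\mu^{-1/2})$ for all sufficiently negative $t$. **Rate functionals and quasi-potential.** For $t_1<t_2$, $z_0\in\mathcal{H}$ and $\psi\in L^2((t_1,t_2);H)$, let $z^\mu_{z_0,\psi}\in C([t_1,t_2];\mathcal{H})$ be the unique solution of $$z(t)=S_\mu(t-t_1)z_0-\int_{t_1}^tS_\mu(t-s)Q_\mu Q\,DF(\Pi_1z(s))\,ds+\int_{t_1}^tS_\mu(t-s)Q_\mu\psi(s)\,ds .$$ For $z\in C([t_1,t_2];\mathcal{H})$, $$I^\mu_{t_1,t_2}(z)=\tfrac12\inf\left\{|\psi|^2_{L^2((t_1,t_2);H)}:\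 z=z^\mu_{z(t_1),\psi}\right\},\qquad \inf\emptyset=+\infty,$$ and for $z\in C((-\infty,0];\mathcal{H})$, $I^\mu_{-\infty}(z)=\sup_{t<0}I^\mu_{t,0}(z)$. The quasi-potential is $$V^\mu(x,y)=\inf\left\{I^\mu_{0,T}(z):\ T>0,\ z\in C([0,T];\mathcal{H}),\ z(0)=0,\ z(T)=(x,y)\right\}.$$ *)

theory Defs
  imports "HOL-Analysis.Analysis"
begin

section \<open>The domain and the Dirichlet Laplacian\<close>

definition bounded_domain :: "'a::euclidean_space set \<Rightarrow> bool" where
  "bounded_domain \<Omega> \<longleftrightarrow> open \<Omega> \<and> connected \<Omega> \<and> \<Omega> \<noteq> {} \<and> bounded \<Omega>"

text \<open>
  ``Regular boundary'' is read as: locally, after a rotation, \<open>\<Omega>\<close> is the strict epigraph of a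
  Lipschitz function of the coordinates orthogonal to \<open>\<nu>\<close>. Boundaries of class \<open>C^k\<close> with
  \<open>k \<ge> 1\<close> satisfy this.
\<close>

definition regular_boundary :: "'a::euclidean_space set \<Rightarrow> bool" where
  "regular_boundary \<Omega> \<longleftrightarrow>
     (\<forall>p \<in> frontier \<Omega>. \<exists>r>0. \<exists>\<nu> L. \<exists>g :: 'a \<Rightarrow> real.
        norm \<nu> = 1 \<and> L-lipschitz_on UNIV g \<and>
        (\<forall>x \<in> ball p r. x \<in> \<Omega> \<longleftrightarrow> g (x - (x \<bullet> \<nu>) *\<^sub>R \<nu>) < x \<bullet> \<nu>))"

definition partial :: "'a::euclidean_space \<Rightarrow> ('a \<Rightarrow> real) \<Rightarrow> 'a \<Rightarrow> real" where
  "partial i f x = frechet_derivative f (at x) i"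

primrec class_C :: "nat \<Rightarrow> ('a::euclidean_space \<Rightarrow> real) \<Rightarrow> bool" where
  "class_C 0 f \<longleftrightarrow> continuous_on UNIV f"
| "class_C (Suc n) f \<longleftrightarrow>
     (\<forall>x. f differentiable (at x)) \<and> (\<forall>i\<in>Basis. class_C n (partial i f))"

definition test_functions :: "'a::euclidean_space set \<Rightarrow> ('a \<Rightarrow> real) set" where
  "test_functions \<Omega> = {\<phi>. (\<forall>n. class_C n \<phi>) \<and>
     compact (closure {x. \<phi> x \<noteq> 0}) \<and> closure {x. \<phi> x \<noteq> 0} \<subseteq> \<Omega>}"

definition laplace :: "('a::euclidean_space \<Rightarrow> real) \<Rightarrow> 'a \<Rightarrow> real" where
  "laplace f x = (\<Sum>i\<in>Basis. partial i (partial i f) x)"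

definition square_integrable :: "'a::euclidean_space set \<Rightarrow> ('a \<Rightarrow> real) set" where
  "square_integrable \<Omega> = {f \<in> borel_measurable (lebesgue_on \<Omega>).
     integrable (lebesgue_on \<Omega>) (\<lambda>x. (f x)\<^sup>2)}"

text \<open>
  The spaces \<open>L\<^sup>2(\<Omega>)\<close> are not available as types. A Hilbert space type \<open>'h\<close> is tied to
  \<open>L\<^sup>2(\<Omega>)\<close> by a map \<open>J\<close> that selects a representative of each element: modulo equality
  almost everywhere, \<open>J\<close> is a linear isometry onto the square integrable functions.
\<close>

definition L2_realization ::
    "'a::euclidean_space set \<Rightarrow> ('h::real_inner \<Rightarrow> 'a \<Rightarrow> real) \<Rightarrow> bool" where
  "L2_realization \<Omega> J \<longleftrightarrow>
     (\<forall>u. J u \<in> square_integrable \<Omega>) \<and>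
     (\<forall>u v. AE x in lebesgue_on \<Omega>. J (u + v) x = J u x + J v x) \<and>
     (\<forall>c u. AE x in lebesgue_on \<Omega>. J (c *\<^sub>R u) x = c * J u x) \<and>
     (\<forall>u v. u \<bullet> v = integral\<^sup>L (lebesgue_on \<Omega>) (\<lambda>x. J u x * J v x)) \<and>
     (\<forall>f \<in> square_integrable \<Omega>. \<exists>u. AE x in lebesgue_on \<Omega>. J u x = f x)"

text \<open>The closure of the test functions in the Sobolev space \<open>W^{1,2}(\<Omega>)\<close>; \<open>G i\<close> is the
  \<open>i\<close>-th weak partial derivative of \<open>u\<close>.\<close>

definition sobolev_H10 :: "'a::euclidean_space set \<Rightarrow> ('a \<Rightarrow> real) set" where
  "sobolev_H10 \<Omega> = {u \<in> square_integrable \<Omega>.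
     \<exists>(\<phi> :: nat \<Rightarrow> 'a \<Rightarrow> real) (G :: 'a \<Rightarrow> 'a \<Rightarrow> real).
       (\<forall>n. \<phi> n \<in> test_functions \<Omega>) \<and> (\<forall>i\<in>Basis. G i \<in> square_integrable \<Omega>) \<and>
       (\<lambda>n. integral\<^sup>L (lebesgue_on \<Omega>) (\<lambda>x. (\<phi> n x - u x)\<^sup>2)) \<longlonglongrightarrow> 0 \<and>
       (\<forall>i\<in>Basis.
          (\<lambda>n. integral\<^sup>L (lebesgue_on \<Omega>) (\<lambda>x. (partial i (\<phi> n) x - G i x)\<^sup>2)) \<longlonglongrightarrow> 0)}"

text \<open>
  The graph of the \<open>L\<^sup>2\<close>-realization of the Laplacian with Dirichlet boundary conditions:
  \<open>u\<close> lies in \<open>H\<^sub>0\<^sup>1(\<Omega>)\<close> and its distributional Laplacian is \<open>f \<in> L\<^sup>2(\<Omega>)\<close>.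
\<close>

definition dirichlet_laplacian ::
    "'a::euclidean_space set \<Rightarrow> ('h::real_inner \<Rightarrow> 'a \<Rightarrow> real) \<Rightarrow> ('h \<times> 'h) set" where
  "dirichlet_laplacian \<Omega> J = {(u, f). J u \<in> sobolev_H10 \<Omega> \<and>
     (\<forall>\<phi> \<in> test_functions \<Omega>.
        integral\<^sup>L (lebesgue_on \<Omega>) (\<lambda>x. J u x * laplace \<phi> x) =
        integral\<^sup>L (lebesgue_on \<Omega>) (\<lambda>x. J f x * \<phi> x))}"

section \<open>Bases, the spaces \<open>H^\<delta>\<close> and diagonal operators\<close>

definition complete_orthonormal :: "(nat \<Rightarrow> 'h::real_inner) \<Rightarrow> bool" where
  "complete_orthonormal e \<longleftrightarrow>
     (\<forall>j k. e j \<bullet> e k = (if j = k then 1 else 0)) \<and> closure (span (range e)) = UNIV"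

definition Hdelta_sqnorm ::
    "(nat \<Rightarrow> real) \<Rightarrow> (nat \<Rightarrow> 'h::real_inner) \<Rightarrow> real \<Rightarrow> 'h \<Rightarrow> real" where
  "Hdelta_sqnorm \<alpha> e \<delta> u = (\<Sum>k. \<alpha> k powr \<delta> * (u \<bullet> e k)\<^sup>2)"

text \<open>For \<open>\<delta> = 1\<close> (and \<open>\<delta> = 0\<close>), \<open>H^\<delta>\<close> is the subspace of \<open>H\<close> on which the norm is finite.\<close>

definition Hdelta :: "(nat \<Rightarrow> real) \<Rightarrow> (nat \<Rightarrow> 'h::real_inner) \<Rightarrow> real \<Rightarrow> 'h set" where
  "Hdelta \<alpha> e \<delta> = {u. summable (\<lambda>k. \<alpha> k powr \<delta> * (u \<bullet> e k)\<^sup>2)}"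

text \<open>
  For \<open>\<delta> \<le> 0\<close>: a complete space \<open>'g\<close> is a completion of the test functions in the
  \<open>H^\<delta>\<close>-norm. The map \<open>\<iota>\<close> is the inclusion of \<open>H\<close> into \<open>H^\<delta>\<close>.
\<close>

definition is_completion ::
    "'a::euclidean_space set \<Rightarrow> ('h::real_inner \<Rightarrow> 'a \<Rightarrow> real) \<Rightarrow> (nat \<Rightarrow> real) \<Rightarrow> (nat \<Rightarrow> 'h) \<Rightarrow> real
      \<Rightarrow> ('h \<Rightarrow> 'g::{real_inner,complete_space}) \<Rightarrow> bool" where
  "is_completion \<Omega> J \<alpha> e \<delta> \<iota> \<longleftrightarrow> linear \<iota> \<and>
     (\<forall>u. (norm (\<iota> u))\<^sup>2 = Hdelta_sqnorm \<alpha> e \<delta> u) \<and>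
     closure (\<iota> ` {u. \<exists>\<phi> \<in> test_functions \<Omega>. AE x in lebesgue_on \<Omega>. J u x = \<phi> x}) = UNIV"

text \<open>
  The operator that maps \<open>b k\<close> to \<open>m k *\<^sub>R b' k\<close>, for an orthogonal, not necessarily normalized,
  basis \<open>b\<close>. With \<open>b\<close> and \<open>b'\<close> among \<open>e\<close> and \<open>\<iota> \<circ> e\<close> this gives the diagonal extension of an
  operator with eigenvalues \<open>m k\<close> to \<open>H\<close> and \<open>H^{-1}\<close>: for \<open>w\<close> in \<open>H^{-1}\<close> the quotient of
  inner products is the \<open>k\<close>-th coefficient of \<open>w\<close> with respect to \<open>e\<close>.
\<close>

definition diag_op ::
    "(nat \<Rightarrow> 'b::real_inner) \<Rightarrow> (nat \<Rightarrow> 'c::real_normed_vector) \<Rightarrow> (nat \<Rightarrow> real) \<Rightarrow> 'b \<Rightarrow> 'c" where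
  "diag_op b b' m w = (\<Sum>k. (m k * ((w \<bullet> b k) / (b k \<bullet> b k))) *\<^sub>R b' k)"

section \<open>The operators on \<open>H \<times> H^{-1}\<close>\<close>

definition C0_semigroup :: "(real \<Rightarrow> 'b::real_normed_vector \<Rightarrow> 'b) \<Rightarrow> bool" where
  "C0_semigroup S \<longleftrightarrow>
     (\<forall>t\<ge>0. bounded_linear (S t)) \<and> (\<forall>z. S 0 z = z) \<and>
     (\<forall>s\<ge>0. \<forall>t\<ge>0. \<forall>z. S (s + t) z = S s (S t z)) \<and>
     (\<forall>z. ((\<lambda>t. S t z) \<longlongrightarrow> z) (at_right 0))"

definition generator :: "(real \<Rightarrow> 'b::real_normed_vector \<Rightarrow> 'b) \<Rightarrow> ('b \<times> 'b) set" where
  "generator S = {(z, w). ((\<lambda>h. (1 / h) *\<^sub>R (S h z - z)) \<longlongrightarrow> w) (at_right 0)}"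

text \<open>The graph of \<open>A\<^sub>\<mu>\<close>, with domain \<open>H\<^sup>1 \<times> H\<close>; here \<open>A\<close> acts from \<open>H\<^sup>1\<close> to \<open>H^{-1}\<close>.\<close>

definition A_mu ::
    "(nat \<Rightarrow> real) \<Rightarrow> (nat \<Rightarrow> 'h::real_inner) \<Rightarrow> ('h \<Rightarrow> 'g::real_inner) \<Rightarrow> real
      \<Rightarrow> (('h \<times> 'g) \<times> ('h \<times> 'g)) set" where
  "A_mu \<alpha> e \<iota> \<mu> =
     {((u, \<iota> v), (v, (1 / \<mu>) *\<^sub>R diag_op e (\<iota> \<circ> e) (\<lambda>k. - \<alpha> k) u - (1 / \<mu>) *\<^sub>R \<iota> v)) | u v.
        u \<in> Hdelta \<alpha> e 1}"

definition Q_mu ::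
    "('h::real_inner \<Rightarrow> 'g::real_inner) \<Rightarrow> ('h \<Rightarrow> 'h) \<Rightarrow> real \<Rightarrow> 'h \<Rightarrow> 'h \<times> 'g" where
  "Q_mu \<iota> Q \<mu> v = (1 / \<mu>) *\<^sub>R (0, \<iota> (Q v))"

text \<open>\<open>(-A)^{-1} Q\<^sup>2\<close> is diagonal with eigenvalues \<open>(q k)\<^sup>2 / \<alpha> k\<close>, where \<open>q k\<close> are those of \<open>Q\<close>.\<close>

definition C_mu ::
    "(nat \<Rightarrow> real) \<Rightarrow> (nat \<Rightarrow> 'h::real_inner) \<Rightarrow> ('h \<Rightarrow> 'g::real_inner) \<Rightarrow> (nat \<Rightarrow> real) \<Rightarrow> real
      \<Rightarrow> 'h \<times> 'g \<Rightarrow> 'h \<times> 'g" where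
  "C_mu \<alpha> e \<iota> q \<mu> z = (1 / 2) *\<^sub>R
     (diag_op e e (\<lambda>k. (q k)\<^sup>2 / \<alpha> k) (fst z),
      (1 / \<mu>) *\<^sub>R diag_op (\<iota> \<circ> e) (\<iota> \<circ> e) (\<lambda>k. (q k)\<^sup>2 / \<alpha> k) (snd z))"

text \<open>The unique nonnegative self-adjoint bounded square root.\<close>

definition op_sqrt :: "('b::real_inner \<Rightarrow> 'b) \<Rightarrow> 'b \<Rightarrow> 'b" where
  "op_sqrt C = (THE R. bounded_linear R \<and> (\<forall>x y. R x \<bullet> y = x \<bullet> R y) \<and>
     (\<forall>x. 0 \<le> R x \<bullet> x) \<and> R \<circ> R = C)"

text \<open>The pseudo-inverse is meaningful on \<open>range R\<close> only; membership is always required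
  separately.\<close>

definition pseudo_inverse :: "('b::real_inner \<Rightarrow> 'b) \<Rightarrow> 'b \<Rightarrow> 'b" where
  "pseudo_inverse R z = (THE w. R w = z \<and> (\<forall>v. R v = 0 \<longrightarrow> w \<bullet> v = 0))"

section \<open>Rate functionals and the quasi-potential\<close>

definition L2_controls :: "real \<Rightarrow> real \<Rightarrow> (real \<Rightarrow> 'h::real_normed_vector) set" where
  "L2_controls t1 t2 = {\<psi>. set_borel_measurable lborel {t1<..<t2} \<psi> \<and>
     set_integrable lborel {t1<..<t2} (\<lambda>s. (norm (\<psi> s))\<^sup>2)}"

definition mild_solution ::
    "(real \<Rightarrow> 'h \<times> 'g \<Rightarrow> 'h \<times> 'g) \<Rightarrow>
      ('h::{real_inner,banach,second_countable_topology}
        \<Rightarrow> 'g::{real_inner,banach,second_countable_topology}) \<Rightarrow>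
      ('h \<Rightarrow> 'h) \<Rightarrow> ('h \<Rightarrow> 'h) \<Rightarrow> real \<Rightarrow> real \<Rightarrow> real \<Rightarrow> 'h \<times> 'g \<Rightarrow> (real \<Rightarrow> 'h) \<Rightarrow>
      (real \<Rightarrow> 'h \<times> 'g) \<Rightarrow> bool" where
  "mild_solution S \<iota> Q DF \<mu> t1 t2 z0 \<psi> z \<longleftrightarrow>
     continuous_on {t1..t2} z \<and>
     (\<forall>t \<in> {t1..t2}. z t = S (t - t1) z0
        - (LINT s:{t1..t}|lborel. S (t - s) (Q_mu \<iota> Q \<mu> (Q (DF (fst (z s))))))
        + (LINT s:{t1..t}|lborel. S (t - s) (Q_mu \<iota> Q \<mu> (\<psi> s))))"

definition rate ::
    "(real \<Rightarrow> 'h \<times> 'g \<Rightarrow> 'h \<times> 'g) \<Rightarrow>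
      ('h::{real_inner,banach,second_countable_topology}
        \<Rightarrow> 'g::{real_inner,banach,second_countable_topology}) \<Rightarrow>
      ('h \<Rightarrow> 'h) \<Rightarrow> ('h \<Rightarrow> 'h) \<Rightarrow> real \<Rightarrow> real \<Rightarrow> real \<Rightarrow> (real \<Rightarrow> 'h \<times> 'g) \<Rightarrow> ennreal" where
  "rate S \<iota> Q DF \<mu> t1 t2 z =
     (INF \<psi> \<in> {\<psi> \<in> L2_controls t1 t2. mild_solution S \<iota> Q DF \<mu> t1 t2 (z t1) \<psi> z}.
        ennreal (1 / 2 * (LINT s:{t1<..<t2}|lborel. (norm (\<psi> s))\<^sup>2)))"

definition rate_minus_infinity ::
    "(real \<Rightarrow> 'h \<times> 'g \<Rightarrow> 'h \<times> 'g) \<Rightarrow>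
      ('h::{real_inner,banach,second_countable_topology}
        \<Rightarrow> 'g::{real_inner,banach,second_countable_topology}) \<Rightarrow>
      ('h \<Rightarrow> 'h) \<Rightarrow> ('h \<Rightarrow> 'h) \<Rightarrow> real \<Rightarrow> (real \<Rightarrow> 'h \<times> 'g) \<Rightarrow> ennreal" where
  "rate_minus_infinity S \<iota> Q DF \<mu> z = (SUP t \<in> {..<0}. rate S \<iota> Q DF \<mu> t 0 z)"

definition quasi_potential ::
    "(real \<Rightarrow> 'h \<times> 'g \<Rightarrow> 'h \<times> 'g) \<Rightarrow>
      ('h::{real_inner,banach,second_countable_topology}
        \<Rightarrow> 'g::{real_inner,banach,second_countable_topology}) \<Rightarrow>
      ('h \<Rightarrow> 'h) \<Rightarrow> ('h \<Rightarrow> 'h) \<Rightarrow> real \<Rightarrow> 'h \<Rightarrow> 'g \<Rightarrow> ennreal" where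
  "quasi_potential S \<iota> Q DF \<mu> x y =
     (INF (T, z) \<in> {(T, z). 0 < T \<and> continuous_on {0..T} z \<and> z 0 = 0 \<and> z T = (x, y)}.
        rate S \<iota> Q DF \<mu> 0 T z)"

end

theory Submission
  imports Defs
begin

text \<open>
  A path from \<open>0\<close> on \<open>[0, T]\<close> is shifted to \<open>[-T, 0]\<close> and continued by \<open>0\<close> to the left. As
  \<open>DF 0 = 0\<close>, the zero path costs nothing, so the right-hand side is at most the quasi-potential.

  Conversely, a path \<open>z\<close> with \<open>C_\<mu>^{-1/2} z t \<rightarrow> 0\<close> is cut off at a very negative time \<open>t\<close>, and \<open>z t\<close> is
  reached from \<open>0\<close> in unit time at a cost of at most a constant times the square of the norm of
  \<open>C_\<mu>^{-1/2} z t\<close>. In the \<open>k\<close>-th mode the steering path is \<open>\<bar>q k\<bar> \<eta> \<phi>\<close>, where \<open>\<phi>\<close> solves the undamped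
  equation \<open>\<mu> \<phi>'' + \<alpha> k \<phi> = 0\<close> and \<open>\<eta>\<close> is a cut-off that vanishes to second order at time \<open>0\<close>. The
  nonlinear drift is compensated by adding \<open>Q (DF u)\<close> to the control, which is Lipschitz in \<open>u\<close>.
\<close>

section \<open>Strongly continuous semigroups\<close>

text \<open>The obstacle is uniformity over the modes. The control acts through \<open>q k\<close>,
  which may vanish or tend to 0, while \<open>\<alpha> k\<close> may be unbounded, so the term
  \<open>\<alpha> k * u / q k\<close> is dangerous for a general steering path. The factor
  \<open>\<bar>q k\<bar>\<close> in the path cancels the division by \<open>q k\<close>, and the
  undamped equation cancels the stiff term against the acceleration. What remains involves only
  \<open>\<phi>\<close>, its velocity and the cut-off. Moreover
  \<open>\<alpha> k * \<phi>^2 + \<mu> * \<phi>'^2\<close> is conserved and equals half the sum of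
  the squares of the two coefficients of \<open>C_mu^{-1/2} z t\<close> in the mode, so this norm is
  exactly the right currency for the cost.

  Mild solutions need not be differentiable. The Duhamel formula is therefore checked for finitely
  many modes, which lie in the domain of the generator, and passes to infinitely many by dominated
  convergence.

  That \<open>DF 0 = 0\<close> follows from the sign condition on \<open>DF\<close> and its
  Lipschitz bound. The steering cost disappears only as \<open>t\<close> tends to minus infinity;
  meanwhile the cost of \<open>z\<close> on \<open>[t, 0]\<close> stays below
  \<open>rate_minus_infinity\<close>.\<close>

locale strongly_continuous_semigroup =
  fixes S :: "real \<Rightarrow> 'b::{banach,second_countable_topology} \<Rightarrow> 'b"
  assumes C0: "C0_semigroup S"
begin

lemma bounded_linear_S: "0 \<le> t \<Longrightarrow> bounded_linear (S t)"
  using C0 by (simp add: C0_semigroup_def)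

lemma S_0 [simp]: "S 0 z = z"
  using C0 by (simp add: C0_semigroup_def)

lemma S_add: "0 \<le> s \<Longrightarrow> 0 \<le> t \<Longrightarrow> S (s + t) z = S s (S t z)"
  using C0 by (simp add: C0_semigroup_def)

lemma S_tendsto_0: "((\<lambda>t. S t z) \<longlongrightarrow> z) (at_right 0)"
  using C0 by (simp add: C0_semigroup_def)

lemma S_zero [simp]: "0 \<le> t \<Longrightarrow> S t 0 = 0"
  using bounded_linear_S linear_0 bounded_linear.linear by blast

text \<open>The uniform boundedness principle: by Baire's theorem one of the closed sets \<open>A n\<close> has an
  interior point, and linearity moves the bound to a neighbourhood of the origin.\<close>

lemma bounded_near_0: "\<exists>\<delta>>0. \<exists>M\<ge>1. \<forall>t\<in>{0..\<delta>}. \<forall>z. norm (S t z) \<le> M * norm z"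
proof -
  \<comment> \<open>Strong continuity bounds \<open>S t z\<close> only for times below a threshold
    that depends on \<open>z\<close>. One index therefore governs both the time window, which
    shrinks, and the bound, which grows.\<close>
  define A where "A n = {z. \<forall>t\<in>{0..1 / real (Suc n)}. norm (S t z) \<le> real n}" for n
  have clA: "closed (A n)" for n
  proof -
    have "A n = (\<Inter>t\<in>{0..1 / real (Suc n)}. {z. norm (S t z) \<le> real n})"
      by (auto simp: A_def)
    moreover have "closed {z. norm (S t z) \<le> real n}" if "t \<in> {0..1 / real (Suc n)}" for t
    proof -
      have "continuous_on UNIV (S t)"
        using bounded_linear_S[of t] that linear_continuous_on by auto
      then show ?thesis
        by (intro closed_Collect_le continuous_intros)
    qed
    ultimately show ?thesis
      by (metis (no_types, lifting) closed_INT)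
  qed
  have cover: "\<exists>n. z \<in> A n" for z
  proof -
    have "((\<lambda>t. norm (S t z)) \<longlongrightarrow> norm z) (at_right 0)"
      by (intro tendsto_norm S_tendsto_0)
    then have "\<forall>\<^sub>F t in at_right 0. norm (S t z) < norm z + 1"
      by (rule order_tendstoD) simp
    then obtain d where d: "d > 0" "\<And>t. 0 < t \<Longrightarrow> t < d \<Longrightarrow> norm (S t z) < norm z + 1"
      unfolding eventually_at_right_field by auto
    obtain n where n: "real n \<ge> norm z + 1 + 1 / d"
      using real_arch_simple by blast
    have "1 / d < real (Suc n)"
      using n norm_ge_zero[of z] by linarith
    then have "1 / real (Suc n) < d"
      using \<open>d > 0\<close> by (simp add: field_simps del: of_nat_Suc)
    moreover have "norm z + 1 \<le> real n"
      using n \<open>d > 0\<close> by (smt (verit) divide_pos_pos)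
    ultimately have "z \<in> A n"
      unfolding A_def using d(2)
      by (smt (verit) S_0 atLeastAtMost_iff mem_Collect_eq)
    then show ?thesis ..
  qed
  have "\<exists>n. interior (A n) \<noteq> {}"
  proof (rule ccontr)
    assume "\<not> ?thesis"
    then have "interior (\<Union>(range A)) = {}"
      using Met_TC.metric_Baire_category_alt[of "range A"] clA
      by (auto simp: complete_UNIV)
    moreover have "\<Union>(range A) = UNIV"
      using cover by auto
    ultimately show False by simp
  qed
  then obtain n z0 r where "r > 0" and ball: "ball z0 r \<subseteq> A n"
    by (meson all_not_in_conv mem_interior)
  \<comment> \<open>The vector \<open>w\<close> below has norm \<open>r / 2\<close> and is a
    difference of two points of the ball, so \<open>norm (S t w)\<close> is at most
    \<open>2 * n\<close>; rescaling gives \<open>4 * n / r\<close>. The maximum with 1 lets powers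
    of \<open>M\<close> serve as bounds later.\<close>
  define M where "M = max 1 (4 * real n / r)"
  have "norm (S t z) \<le> M * norm z" if t: "t \<in> {0..1 / real (Suc n)}" for t z
  proof (cases "z = 0")
    case True
    then show ?thesis using t by simp
  next
    case False
    interpret bounded_linear "S t" using bounded_linear_S t by simp
    define w where "w = (r / (2 * norm z)) *\<^sub>R z"
    have "norm w < r"
      using False \<open>r > 0\<close> by (simp add: w_def)
    then have "z0 + w \<in> A n" "z0 \<in> A n"
      using ball \<open>r > 0\<close> by (auto simp: dist_norm)
    then have "norm (S t (z0 + w)) \<le> n" "norm (S t z0) \<le> n"
      using t by (auto simp: A_def)
    moreover have "norm (S t w) \<le> norm (S t (z0 + w)) + norm (S t z0)"
      using norm_triangle_ineq4[of "S t (z0 + w)" "S t z0"] by (simp add: add)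
    ultimately have "norm (S t w) \<le> 2 * real n"
      by linarith
    moreover have "norm (S t w) = r / (2 * norm z) * norm (S t z)"
      using \<open>r > 0\<close> by (simp add: w_def scale)
    ultimately have "r / (2 * norm z) * norm (S t z) \<le> 2 * n"
      by simp
    then have "norm (S t z) \<le> 4 * n / r * norm z"
      using False \<open>r > 0\<close> by (simp add: field_simps)
    also have "\<dots> \<le> M * norm z"
      by (intro mult_right_mono) (auto simp: M_def)
    finally show ?thesis .
  qed
  moreover have "M \<ge> 1" "1 / real (Suc n) > 0"
    by (auto simp: M_def)
  ultimately show ?thesis by meson
qed

text \<open>Finitely many steps of the length \<open>\<delta>\<close> on which the bound
  \<open>M\<close> holds cover the interval, and by the semigroup law each step costs a factor
  \<open>M\<close>. As \<open>M\<close> is at least 1, the largest power works for all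
  times.\<close>

lemma bounded_on_interval: "\<exists>M\<ge>1. \<forall>t\<in>{0..T}. \<forall>z. norm (S t z) \<le> M * norm z"
proof -
  obtain \<delta> M where \<delta>: "\<delta> > 0" and M: "M \<ge> 1"
    and bd: "\<And>t z. 0 \<le> t \<Longrightarrow> t \<le> \<delta> \<Longrightarrow> norm (S t z) \<le> M * norm z"
    using bounded_near_0 by (metis atLeastAtMost_iff)
  have step: "norm (S t z) \<le> M ^ Suc n * norm z" if "0 \<le> t" "t \<le> real n * \<delta>" for n t z
    using that
  proof (induction n arbitrary: t)
    case 0
    then show ?case using M mult_right_mono[of 1 M "norm z"] by simp
  next
    case (Suc n)
    show ?case
    proof (cases "t \<le> \<delta>")
      case True
      have "norm (S t z) \<le> M * norm z"
        using bd True Suc by simp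
      also have "\<dots> \<le> M ^ Suc (Suc n) * norm z"
        using M by (intro mult_right_mono) (use one_le_power[of M "Suc n"] in auto)
      finally show ?thesis .
    next
      case False
      have "S t z = S \<delta> (S (t - \<delta>) z)"
        using S_add[of \<delta> "t - \<delta>"] False \<delta> by simp
      also have "norm \<dots> \<le> M * norm (S (t - \<delta>) z)"
        using bd \<delta> by simp
      also have "\<dots> \<le> M * (M ^ Suc n * norm z)"
        using False Suc M by (intro mult_left_mono Suc.IH) (auto simp: algebra_simps)
      finally show ?thesis by (simp add: mult.assoc)
    qed
  qed
  obtain n :: nat where "T / \<delta> \<le> n" using real_arch_simple by blast
  then have "T \<le> n * \<delta>" using \<delta> by (simp add: field_simps)
  then have "\<forall>t\<in>{0..T}. \<forall>z. norm (S t z) \<le> M ^ Suc n * norm z"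
    using step by (meson atLeastAtMost_iff order_trans)
  moreover have "M ^ Suc n \<ge> 1" using M by (rule one_le_power)
  ultimately show ?thesis by blast
qed

text \<open>Only right continuity at 0 is given. In
  \<open>S b z - S a z = S a (S (b - a) z - z)\<close> the earlier time \<open>a\<close> is factored
  out; it never exceeds \<open>t\<close>, so one bound on \<open>{0..t}\<close> settles both sides
  of \<open>t\<close>.\<close>

lemma S_continuous_orbit: "continuous_on {0..} (\<lambda>t. S t z)"
  unfolding continuous_on_iff
proof (intro ballI allI impI)
  fix t e :: real assume t: "t \<in> {0..}" and e: "0 < e"
  obtain M where M: "M \<ge> 1" and bd: "\<And>s z. 0 \<le> s \<Longrightarrow> s \<le> t \<Longrightarrow> norm (S s z) \<le> M * norm z"
    using bounded_on_interval[of t] by (metis atLeastAtMost_iff)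
  have "\<forall>\<^sub>F h in at_right 0. dist (S h z) z < e / M"
    using S_tendsto_0 M e by (intro tendstoD) auto
  then obtain d where d: "d > 0" "\<And>h. 0 < h \<Longrightarrow> h < d \<Longrightarrow> dist (S h z) z < e / M"
    unfolding eventually_at_right_field by auto
  have est: "norm (S b z - S a z) < e" if "0 \<le> a" "a \<le> t" "a \<le> b" "b - a < d" for a b
  proof -
    interpret bounded_linear "S a" using bounded_linear_S that by simp
    have lt: "norm (S (b - a) z - z) < e / M"
      using d(2)[of "b - a"] that M e by (cases "a = b") (auto simp: dist_norm)
    have "S b z - S a z = S a (S (b - a) z - z)"
      using S_add[of a "b - a" z] that by (simp add: diff)
    also have "norm \<dots> \<le> M * norm (S (b - a) z - z)"
      using bd that by simp
    also have "\<dots> < M * (e / M)"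
      using lt M by (intro mult_strict_left_mono) auto
    finally show ?thesis using M by simp
  qed
  show "\<exists>d>0. \<forall>s\<in>{0..}. dist s t < d \<longrightarrow> dist (S s z) (S t z) < e"
  proof (intro exI[of _ d] conjI ballI impI)
    fix s assume "s \<in> {0..}" "dist s t < d"
    then show "dist (S s z) (S t z) < e"
      using est[of s t] est[of t s] t
      by (cases "s \<le> t") (auto simp: dist_norm norm_minus_commute)
  qed (rule d)
qed

text \<open>Negative times are cut off by \<open>max 0\<close> because nothing is assumed about \<open>S t\<close> for \<open>t < 0\<close>.\<close>

lemma S_jointly_continuous: "continuous_on UNIV (\<lambda>p. S (max 0 (fst p)) (snd p))"
  unfolding continuous_on_def
proof
  fix p :: "real \<times> 'b"
  obtain M where M: "M \<ge> 1"
    and bd: "\<And>s z. 0 \<le> s \<Longrightarrow> s \<le> max 0 (fst p) + 1 \<Longrightarrow> norm (S s z) \<le> M * norm z"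
    using bounded_on_interval[of "max 0 (fst p) + 1"] by (metis atLeastAtMost_iff)
  define g where "g r = M * norm (snd r - snd p) + norm (S (max 0 (fst r)) (snd p) - S (max 0 (fst p)) (snd p))"
    for r :: "real \<times> 'b"
  have orb: "((\<lambda>r. S (max 0 (fst r)) (snd p)) \<longlongrightarrow> S (max 0 (fst p)) (snd p)) (at p)"
    by (rule continuous_on_tendsto_compose[OF S_continuous_orbit]) (auto intro!: tendsto_eq_intros)
  have "(g \<longlongrightarrow> M * norm (snd p - snd p) + norm (S (max 0 (fst p)) (snd p) - S (max 0 (fst p)) (snd p))) (at p)"
    unfolding g_def by (intro tendsto_intros orb)
  then have g0: "(g \<longlongrightarrow> 0) (at p)" by simp
  have "((\<lambda>r. fst r) \<longlongrightarrow> fst p) (at p)" by (intro tendsto_intros)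
  then have "\<forall>\<^sub>F r in at p. fst r < max 0 (fst p) + 1"
    by (rule order_tendstoD) auto
  then have "\<forall>\<^sub>F r in at p. norm (S (max 0 (fst r)) (snd r) - S (max 0 (fst p)) (snd p)) \<le> g r"
  proof eventually_elim
    case (elim r)
    interpret bounded_linear "S (max 0 (fst r))" using bounded_linear_S by simp
    have "S (max 0 (fst r)) (snd r) - S (max 0 (fst p)) (snd p) =
        S (max 0 (fst r)) (snd r - snd p) + (S (max 0 (fst r)) (snd p) - S (max 0 (fst p)) (snd p))"
      by (simp add: diff)
    also have "norm \<dots> \<le> g r"
      unfolding g_def using elim by (intro norm_triangle_mono bd) auto
    finally show ?case .
  qed
  then have "((\<lambda>r. S (max 0 (fst r)) (snd r) - S (max 0 (fst p)) (snd p)) \<longlongrightarrow> 0) (at p)"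
    using g0 by (rule Lim_null_comparison)
  then show "((\<lambda>r. S (max 0 (fst r)) (snd r)) \<longlongrightarrow> S (max 0 (fst p)) (snd p)) (at p within UNIV)"
    by (simp add: LIM_zero_iff)
qed

lemma S_tendsto:
  assumes "(f \<longlongrightarrow> t) G" "(g \<longlongrightarrow> z) G" "0 \<le> t" "\<forall>\<^sub>F i in G. 0 \<le> f i"
  shows "((\<lambda>i. S (f i) (g i)) \<longlongrightarrow> S t z) G"
proof -
  have "((\<lambda>i. S (max 0 (fst (f i, g i))) (snd (f i, g i))) \<longlongrightarrow> S (max 0 (fst (t, z))) (snd (t, z))) G"
    by (rule continuous_on_tendsto_compose[OF S_jointly_continuous])
      (use assms in \<open>auto intro!: tendsto_intros\<close>)
  moreover have "\<forall>\<^sub>F i in G. S (max 0 (f i)) (g i) = S (f i) (g i)"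
    using assms(4) by eventually_elim (simp add: max_def)
  ultimately show ?thesis
    using assms(3) by (simp add: tendsto_cong max_def)
qed

lemma continuous_on_S:
  assumes "continuous_on X f" "continuous_on X g" "\<And>x. x \<in> X \<Longrightarrow> 0 \<le> f x"
  shows "continuous_on X (\<lambda>x. S (f x) (g x))"
  using assms unfolding continuous_on_def
  by (auto intro!: S_tendsto simp: eventually_at_filter)

text \<open>To the right, the continuous operator \<open>S t\<close> is applied to the difference
  quotient at 0. To the left, the operator \<open>S (t - h)\<close> varies together with the
  quotient, which is where the joint continuity behind \<open>S_tendsto\<close> enters.\<close>

lemma S_has_vector_derivative:
  assumes "(x, y) \<in> generator S" "0 \<le> t"
  shows "((\<lambda>t. S t x) has_vector_derivative S t y) (at t within {0..})"
proof -
  have gen: "((\<lambda>h. (1 / h) *\<^sub>R (S h x - x)) \<longlongrightarrow> y) (at_right 0)"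
    using assms(1) by (simp add: generator_def)
  define D where "D s = (1 / (s - t)) *\<^sub>R (S s x - S t x)" for s
  have right: "(D \<longlongrightarrow> S t y) (at_right t)"
  proof -
    have "((\<lambda>h. S t ((1 / h) *\<^sub>R (S h x - x))) \<longlongrightarrow> S t y) (at_right 0)"
      using gen assms(2) by (intro S_tendsto) auto
    moreover have "\<forall>\<^sub>F h in at_right 0. S t ((1 / h) *\<^sub>R (S h x - x)) = D (h + t)"
      using eventually_at_right_less[of 0]
    proof eventually_elim
      case (elim h)
      interpret bounded_linear "S t" using bounded_linear_S assms(2) .
      show ?case
        using S_add[of t h x] elim assms(2) by (simp add: D_def scale diff add.commute)
    qed
    ultimately have "((\<lambda>h. D (h + t)) \<longlongrightarrow> S t y) (at_right 0)"
      by (simp add: tendsto_cong)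
    then show ?thesis
      by (simp add: filterlim_at_right_to_0[of D _ t])
  qed
  have left: "(D \<longlongrightarrow> S t y) (at_left t)" if "0 < t"
  proof -
    have small: "\<forall>\<^sub>F h in at_right 0. h < t"
      using that eventually_at_right_real by (auto simp: eventually_at_right_field)
    have pos: "\<forall>\<^sub>F h in at_right (0::real). 0 < h" by (rule eventually_at_right_less)
    have lim: "((\<lambda>h. t - h) \<longlongrightarrow> t) (at_right 0)"
      by (auto intro!: tendsto_eq_intros)
    have "((\<lambda>h. S (t - h) ((1 / h) *\<^sub>R (S h x - x))) \<longlongrightarrow> S t y) (at_right 0)"
      using small by (intro S_tendsto gen lim assms(2)) (auto elim: eventually_mono)
    moreover have "\<forall>\<^sub>F h in at_right 0. S (t - h) ((1 / h) *\<^sub>R (S h x - x)) = D (t - h)"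
      using small pos
    proof eventually_elim
      case (elim h)
      interpret bounded_linear "S (t - h)" using bounded_linear_S elim by simp
      show ?case
        using S_add[of "t - h" h x] elim
        by (simp add: D_def scale diff scaleR_diff_right)
    qed
    ultimately have "((\<lambda>h. D (t - h)) \<longlongrightarrow> S t y) (at_right 0)"
      by (simp add: tendsto_cong)
    then have "((\<lambda>h. D (- (h + - t))) \<longlongrightarrow> S t y) (at_right 0)"
      by (simp add: algebra_simps)
    then have "((\<lambda>s. D (- s)) \<longlongrightarrow> S t y) (at_right (- t))"
      using filterlim_at_right_to_0[of "\<lambda>s. D (- s)" _ "- t"] by simp
    then show ?thesis
      by (simp add: at_left_minus[of t] filterlim_filtermap)
  qed
  have "(D \<longlongrightarrow> S t y) (at t within {0..})"
  proof (cases "t = 0")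
    case True
    then show ?thesis using right by (simp add: at_within_Ici_at_right)
  next
    case False
    then have "0 < t" using assms(2) by simp
    then have "(D \<longlongrightarrow> S t y) (at t)"
      using left right by (simp add: filterlim_at_split)
    then show ?thesis by (rule tendsto_within_subset) simp
  qed
  then have "((\<lambda>s. norm (D s - S t y)) \<longlongrightarrow> 0) (at t within {0..})"
    by (simp add: tendsto_norm_zero_iff LIM_zero_iff)
  moreover have "norm (D s - S t y) = norm (S s x - S t x - (s - t) *\<^sub>R S t y) / norm (s - t)"
    if "s \<noteq> t" for s
  proof -
    have "S s x - S t x - (s - t) *\<^sub>R S t y = (s - t) *\<^sub>R (D s - S t y)"
      using that by (simp add: D_def algebra_simps)
    then show ?thesis using that by simp
  qed
  ultimately have "((\<lambda>s. norm (S s x - S t x - (s - t) *\<^sub>R S t y) / norm (s - t)) \<longlongrightarrow> 0)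
      (at t within {0..})"
    by (elim Lim_transform_eventually) (auto simp: eventually_at_filter)
  then show ?thesis
    unfolding has_vector_derivative_def has_derivative_iff_norm
    by (simp add: bounded_linear_scaleR_left)
qed

lemma set_integrable_S:
  assumes "set_integrable lborel {a..t} g"
  shows "set_integrable lborel {a..t} (\<lambda>s. S (t - s) (g s))"
proof -
  obtain M where M: "M \<ge> 1" and bd: "\<And>s z. 0 \<le> s \<Longrightarrow> s \<le> t - a \<Longrightarrow> norm (S s z) \<le> M * norm z"
    using bounded_on_interval[of "t - a"] by (metis atLeastAtMost_iff)
  define G where "G s = indicator {a..t} s *\<^sub>R g s" for s
  have G: "integrable lborel G"
    using assms unfolding set_integrable_def G_def .
  \<comment> \<open>Outside the interval \<open>G\<close> vanishes and \<open>S\<close> maps 0 to 0.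
    So the cut-off integrand is a jointly continuous function of \<open>s\<close> and the measurable
    \<open>G s\<close>, hence measurable.\<close>
  have eq: "indicator {a..t} s *\<^sub>R S (t - s) (g s) = S (max 0 (t - s)) (G s)" for s
    by (auto simp: G_def indicator_def)
  have "integrable lborel (\<lambda>s. S (max 0 (t - s)) (G s))"
  proof (rule Bochner_Integration.integrable_bound)
    show "integrable lborel (\<lambda>s. M *\<^sub>R G s)" using G by simp
    show "(\<lambda>s. S (max 0 (t - s)) (G s)) \<in> borel_measurable lborel"
      by (rule borel_measurable_continuous_Pair[where H = "\<lambda>r z. S (max 0 r) z"])
        (use G S_jointly_continuous in auto)
    show "AE s in lborel. norm (S (max 0 (t - s)) (G s)) \<le> norm (M *\<^sub>R G s)"
      using M bd by (auto simp: G_def indicator_def)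
  qed
  then show ?thesis
    by (simp add: set_integrable_def eq)
qed

lemma S_set_integral:
  assumes "set_integrable lborel {a..t} g" "0 \<le> r"
  shows "S r (LINT s:{a..t}|lborel. S (t - s) (g s)) = (LINT s:{a..t}|lborel. S (r + t - s) (g s))"
proof -
  interpret r: bounded_linear "S r" using bounded_linear_S assms(2) .
  have "S r (LINT s:{a..t}|lborel. S (t - s) (g s)) =
      (LINT s|lborel. S r (indicator {a..t} s *\<^sub>R S (t - s) (g s)))"
    unfolding set_lebesgue_integral_def
    using set_integrable_S[OF assms(1)]
    by (intro integral_bounded_linear[symmetric] bounded_linear_S assms(2)) (simp add: set_integrable_def)
  also have "\<dots> = (LINT s:{a..t}|lborel. S (r + t - s) (g s))"
  proof -
    have "S (r + t - s) (g s) = S r (S (t - s) (g s))" if "s \<le> t" for s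
      using S_add[of r "t - s"] assms(2) that by (simp add: add_diff_eq)
    then show ?thesis
      unfolding set_lebesgue_integral_def
      by (intro Bochner_Integration.integral_cong) (auto simp: indicator_def)
  qed
  finally show ?thesis .
qed

text \<open>The semigroup law factors \<open>S (t - r)\<close> out of the part up to
  \<open>r\<close>. Restriction and concatenation of mild solutions both rest on this cocycle
  identity.\<close>

lemma Duhamel_split:
  assumes g: "set_integrable lborel {a..t} g" and r: "a \<le> r" "r \<le> t"
  shows "(LINT s:{a..t}|lborel. S (t - s) (g s)) =
    S (t - r) (LINT s:{a..r}|lborel. S (r - s) (g s)) + (LINT s:{r..t}|lborel. S (t - s) (g s))"
proof -
  have gr: "set_integrable lborel {a..r} g"
    by (rule set_integrable_subset[OF g]) (use r in auto)
  have int: "set_integrable lborel {a..r} (\<lambda>s. S (t - s) (g s))"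
     "set_integrable lborel {r<..t} (\<lambda>s. S (t - s) (g s))"
    by (rule set_integrable_subset[OF set_integrable_S[OF g]]; use r in auto)+
  have "(LINT s:{a..t}|lborel. S (t - s) (g s)) =
      (LINT s:{a..r}|lborel. S (t - s) (g s)) + (LINT s:{r<..t}|lborel. S (t - s) (g s))"
    using set_integral_Un[OF _ int] r by (simp add: ivl_disj_un ivl_disj_int)
  also have "(LINT s:{a..r}|lborel. S (t - s) (g s)) = S (t - r) (LINT s:{a..r}|lborel. S (r - s) (g s))"
    using S_set_integral[OF gr, of "t - r"] r by simp
  also have "(LINT s:{r<..t}|lborel. S (t - s) (g s)) = (LINT s:{r..t}|lborel. S (t - s) (g s))"
    by (rule set_integral_discrete_difference[where X = "{r}"]) auto
  finally show ?thesis .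
qed

end

section \<open>Diagonal operators and square roots\<close>

lemma norm_orthonormal_sum:
  fixes b :: "nat \<Rightarrow> 'h::real_inner"
  assumes "\<And>j k. b j \<bullet> b k = (if j = k then 1 else 0)" "finite A"
  shows "(norm (\<Sum>k\<in>A. c k *\<^sub>R b k))\<^sup>2 = (\<Sum>k\<in>A. (c k)\<^sup>2)"
proof -
  have "(norm (\<Sum>k\<in>A. c k *\<^sub>R b k))\<^sup>2 = (\<Sum>j\<in>A. \<Sum>k\<in>A. c j * (c k * (b j \<bullet> b k)))"
    by (simp add: power2_norm_eq_inner inner_sum_left inner_sum_right sum_distrib_left mult.commute mult.left_commute)
      (simp add: inner_commute mult.left_commute)
  also have "\<dots> = (\<Sum>j\<in>A. \<Sum>k\<in>A. if k = j then (c j)\<^sup>2 else 0)"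
    by (intro sum.cong) (auto simp: assms(1) power2_eq_square)
  also have "\<dots> = (\<Sum>j\<in>A. (c j)\<^sup>2)"
    using assms(2) by simp
  finally show ?thesis .
qed

locale orthonormal_basis =
  fixes b :: "nat \<Rightarrow> 'h::{real_inner,banach}"
  assumes complete: "complete_orthonormal b"
begin

lemma inner_basis: "b j \<bullet> b k = (if j = k then 1 else 0)"
  using complete by (auto simp: complete_orthonormal_def)

lemmas norm_basis_sum = norm_orthonormal_sum[of b, OF inner_basis]

lemma Bessel_sum:
  assumes "finite A"
  shows "(\<Sum>k\<in>A. (u \<bullet> b k)\<^sup>2) \<le> (norm u)\<^sup>2"
proof -
  define p where "p = (\<Sum>k\<in>A. (u \<bullet> b k) *\<^sub>R b k)"
  have pp: "p \<bullet> p = (\<Sum>k\<in>A. (u \<bullet> b k)\<^sup>2)"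
    using norm_basis_sum[OF assms, of "\<lambda>k. u \<bullet> b k"] by (simp add: p_def power2_norm_eq_inner)
  have up: "u \<bullet> p = (\<Sum>k\<in>A. (u \<bullet> b k)\<^sup>2)"
    by (simp add: p_def inner_sum_right power2_eq_square)
  have "0 \<le> (u - p) \<bullet> (u - p)" by simp
  then show ?thesis
    using pp up by (simp add: power2_norm_eq_inner inner_diff inner_commute)
qed

lemma summable_coeffs: "summable (\<lambda>k. (u \<bullet> b k)\<^sup>2)"
  by (rule bounded_imp_summable[of _ "(norm u)\<^sup>2"]) (use Bessel_sum[of "{..n}" u for n] in auto)

lemma Bessel: "(\<Sum>k. (u \<bullet> b k)\<^sup>2) \<le> (norm u)\<^sup>2"
  by (rule suminf_le_const[OF summable_coeffs]) (simp add: Bessel_sum)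

text \<open>A Weierstrass test in which orthogonality replaces absolute by square summability: the
  squared norm of a block of the series is the sum of its squared coefficients, so the partial sums
  are uniformly Cauchy.\<close>

lemma uniform_limit_series:
  assumes "\<And>k x. x \<in> X \<Longrightarrow> \<bar>c k x\<bar> \<le> g k" "summable (\<lambda>k. (g k)\<^sup>2)"
  shows "uniform_limit X (\<lambda>n x. \<Sum>k<n. c k x *\<^sub>R b k) (\<lambda>x. \<Sum>k. c k x *\<^sub>R b k) sequentially"
proof -
  have "uniformly_Cauchy_on X (\<lambda>n x. \<Sum>k<n. c k x *\<^sub>R b k)"
    unfolding uniformly_Cauchy_on_def
  proof (intro allI impI)
    fix \<epsilon> :: real assume "\<epsilon> > 0"
    then obtain N where N: "\<And>m n. m \<ge> N \<Longrightarrow> norm (\<Sum>k=m..<n. (g k)\<^sup>2) < \<epsilon>\<^sup>2"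
      using assms(2) unfolding summable_Cauchy by (metis zero_less_power)
    have est: "dist (\<Sum>k<n. c k x *\<^sub>R b k) (\<Sum>k<m. c k x *\<^sub>R b k) < \<epsilon>"
      if "x \<in> X" "m \<ge> N" "m \<le> n" for x m n
    proof -
      have "(\<Sum>k<n. c k x *\<^sub>R b k) - (\<Sum>k<m. c k x *\<^sub>R b k) = (\<Sum>k=m..<n. c k x *\<^sub>R b k)"
        using that sum_diff_nat_ivl[of 0 m n "\<lambda>k. c k x *\<^sub>R b k"] by (simp add: atLeast0LessThan)
      then have "(dist (\<Sum>k<n. c k x *\<^sub>R b k) (\<Sum>k<m. c k x *\<^sub>R b k))\<^sup>2 = (\<Sum>k=m..<n. (c k x)\<^sup>2)"
        using norm_basis_sum[of "{m..<n}" "\<lambda>k. c k x"] by (simp add: dist_norm)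
      also have "\<dots> \<le> (\<Sum>k=m..<n. (g k)\<^sup>2)"
      proof (rule sum_mono)
        fix k show "(c k x)\<^sup>2 \<le> (g k)\<^sup>2"
          using power_mono[OF assms(1)[OF that(1), of k] abs_ge_zero, of 2] by simp
      qed
      also have "\<dots> < \<epsilon>\<^sup>2"
        using N[of m n] that by auto
      finally show ?thesis
        using \<open>\<epsilon> > 0\<close> by (simp add: power2_less_imp_less)
    qed
    show "\<exists>M. \<forall>x\<in>X. \<forall>m\<ge>M. \<forall>n\<ge>M. dist (\<Sum>k<m. c k x *\<^sub>R b k) (\<Sum>k<n. c k x *\<^sub>R b k) < \<epsilon>"
    proof (intro exI[of _ N] ballI allI impI)
      fix x m n assume "x \<in> X" "N \<le> m" "N \<le> n"
      then show "dist (\<Sum>k<m. c k x *\<^sub>R b k) (\<Sum>k<n. c k x *\<^sub>R b k) < \<epsilon>"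
        using est[of x m n] est[of x n m] by (cases "m \<le> n") (auto simp: dist_commute)
    qed
  qed
  then have "uniformly_convergent_on X (\<lambda>n x. \<Sum>k<n. c k x *\<^sub>R b k)"
    by (simp add: uniformly_convergent_eq_Cauchy)
  then obtain l where l: "uniform_limit X (\<lambda>n x. \<Sum>k<n. c k x *\<^sub>R b k) l sequentially"
    unfolding uniformly_convergent_on_def by blast
  moreover have "l x = (\<Sum>k. c k x *\<^sub>R b k)" if "x \<in> X" for x
    using tendsto_uniform_limitI[OF l that] by (intro sums_unique) (simp add: sums_def)
  ultimately show ?thesis
    by (subst uniform_limit_cong'[of X _ "\<lambda>n x. \<Sum>k<n. c k x *\<^sub>R b k" _ l]) auto
qed

lemma series_sums:
  assumes "summable (\<lambda>k. (c k)\<^sup>2)"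
  shows "(\<lambda>k. c k *\<^sub>R b k) sums (\<Sum>k. c k *\<^sub>R b k)"
proof -
  have "uniform_limit {()} (\<lambda>n x. \<Sum>k<n. c k *\<^sub>R b k) (\<lambda>x. \<Sum>k. c k *\<^sub>R b k) sequentially"
    by (rule uniform_limit_series[where g = "\<lambda>k. \<bar>c k\<bar>"]) (use assms in auto)
  then show ?thesis
    unfolding sums_def by (rule tendsto_uniform_limitI) simp
qed

lemma norm_series:
  assumes "summable (\<lambda>k. (c k)\<^sup>2)"
  shows "(norm (\<Sum>k. c k *\<^sub>R b k))\<^sup>2 = (\<Sum>k. (c k)\<^sup>2)"
proof (rule LIMSEQ_unique)
  show "(\<lambda>n. (norm (\<Sum>k<n. c k *\<^sub>R b k))\<^sup>2) \<longlonglongrightarrow> (norm (\<Sum>k. c k *\<^sub>R b k))\<^sup>2"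
    using series_sums[OF assms] unfolding sums_def by (intro tendsto_intros)
  show "(\<lambda>n. (norm (\<Sum>k<n. c k *\<^sub>R b k))\<^sup>2) \<longlonglongrightarrow> (\<Sum>k. (c k)\<^sup>2)"
    using summable_LIMSEQ[OF assms] by (simp add: norm_basis_sum)
qed

lemma norm_series_le:
  assumes "\<And>k. \<bar>c k\<bar> \<le> B * g k" "summable (\<lambda>k. (g k)\<^sup>2)"
  shows "summable (\<lambda>k. (c k)\<^sup>2)" "(norm (\<Sum>k. c k *\<^sub>R b k))\<^sup>2 \<le> B\<^sup>2 * (\<Sum>k. (g k)\<^sup>2)"
proof -
  have le: "(c k)\<^sup>2 \<le> B\<^sup>2 * (g k)\<^sup>2" for k
    using assms(1)[of k] by (metis abs_ge_zero power2_abs power_mono power_mult_distrib)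
  show *: "summable (\<lambda>k. (c k)\<^sup>2)"
    by (rule summable_comparison_test[of _ "\<lambda>k. B\<^sup>2 * (g k)\<^sup>2"])
      (use le assms(2) in \<open>auto intro: summable_mult\<close>)
  show "(norm (\<Sum>k. c k *\<^sub>R b k))\<^sup>2 \<le> B\<^sup>2 * (\<Sum>k. (g k)\<^sup>2)"
    unfolding norm_series[OF *] suminf_mult[OF assms(2), symmetric]
    by (rule suminf_le[OF le * summable_mult[OF assms(2)]])
qed

lemma inner_series:
  assumes "summable (\<lambda>k. (c k)\<^sup>2)"
  shows "(\<Sum>k. c k *\<^sub>R b k) \<bullet> b j = c j"
proof -
  have "(\<lambda>k. (c k *\<^sub>R b k) \<bullet> b j) sums ((\<Sum>k. c k *\<^sub>R b k) \<bullet> b j)"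
    by (rule bounded_linear.sums[OF bounded_linear_inner_left series_sums[OF assms]])
  moreover have "(\<lambda>k. (c k *\<^sub>R b k) \<bullet> b j) = (\<lambda>k. if k = j then c j else 0)"
    by (auto simp: inner_basis)
  ultimately have "(\<lambda>k. if k = j then c j else 0) sums ((\<Sum>k. c k *\<^sub>R b k) \<bullet> b j)"
    by simp
  from sums_unique2[OF this sums_single[of j "\<lambda>_. c j"]] show ?thesis .
qed

text \<open>Agreement passes from the basis to its span by linearity and to the closure by
  continuity.\<close>

lemma bounded_linear_eqI:
  fixes f g :: "'h \<Rightarrow> 'c::real_normed_vector"
  assumes "bounded_linear f" "bounded_linear g" "\<And>k. f (b k) = g (b k)"
  shows "f = g"
proof
  fix u
  interpret f: bounded_linear f by fact
  interpret g: bounded_linear g by fact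
  have "f v = g v" if "v \<in> span (range b)" for v
    by (rule linear_eq_on_span[OF f.linear_axioms g.linear_axioms _ that]) (use assms(3) in auto)
  then have "span (range b) \<subseteq> {v. f v = g v}" by blast
  moreover have "closed {v. f v = g v}"
    by (intro closed_Collect_eq linear_continuous_on assms)
  ultimately have "closure (span (range b)) \<subseteq> {v. f v = g v}"
    by (rule closure_minimal)
  then show "f u = g u"
    using complete by (auto simp: complete_orthonormal_def)
qed

section \<open>Diagonal operators in an orthonormal basis\<close>

lemma diag_op_eq: "diag_op b b' m w = (\<Sum>k. (m k * (w \<bullet> b k)) *\<^sub>R b' k)"
  by (simp add: diag_op_def inner_basis)

lemma summable_diag:
  assumes "\<And>k. \<bar>m k\<bar> \<le> B"
  shows "summable (\<lambda>k. (m k * (w \<bullet> b k))\<^sup>2)"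
  by (rule norm_series_le[where B = B and g = "\<lambda>k. \<bar>w \<bullet> b k\<bar>"])
    (simp_all add: abs_mult mult_right_mono assms summable_coeffs)

lemma norm_diag_op_le:
  assumes "\<And>k. \<bar>m k\<bar> \<le> B"
  shows "norm (diag_op b b m w) \<le> B * norm w"
proof -
  have "B \<ge> 0" using assms[of 0] by linarith
  have "(norm (diag_op b b m w))\<^sup>2 \<le> B\<^sup>2 * (\<Sum>k. (\<bar>w \<bullet> b k\<bar>)\<^sup>2)"
    unfolding diag_op_eq
    by (rule norm_series_le) (simp_all add: abs_mult mult_right_mono assms summable_coeffs)
  also have "\<dots> \<le> B\<^sup>2 * (norm w)\<^sup>2"
    using Bessel[of w] by (intro mult_left_mono) simp_all
  also have "\<dots> = (B * norm w)\<^sup>2"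
    by (simp add: power_mult_distrib)
  finally show ?thesis
    by (rule power2_le_imp_le) (use \<open>B \<ge> 0\<close> in simp)
qed

lemma inner_diag_op:
  assumes "\<And>k. \<bar>m k\<bar> \<le> B"
  shows "diag_op b b m w \<bullet> b j = m j * (w \<bullet> b j)"
  unfolding diag_op_eq by (rule inner_series[OF summable_diag[OF assms]])

lemma bounded_linear_diag_op:
  assumes "\<And>k. \<bar>m k\<bar> \<le> B"
  shows "bounded_linear (diag_op b b m)"
proof (rule bounded_linear_intro[where K = B])
  have s: "(\<lambda>k. (m k * (w \<bullet> b k)) *\<^sub>R b k) sums diag_op b b m w" for w
    unfolding diag_op_eq by (rule series_sums[OF summable_diag[OF assms]])
  fix v w :: 'h and r :: real
  show "diag_op b b m (v + w) = diag_op b b m v + diag_op b b m w"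
    using sums_unique[OF sums_add[OF s[of v] s[of w]]]
    by (simp add: diag_op_eq inner_add_left distrib_left scaleR_add_left)
  show "diag_op b b m (r *\<^sub>R v) = r *\<^sub>R diag_op b b m v"
    using sums_unique[OF sums_scaleR_right[OF s[of v], of r]]
    by (simp add: diag_op_eq mult.left_commute)
  show "norm (diag_op b b m v) \<le> norm v * B"
    using norm_diag_op_le[OF assms] by (simp add: mult.commute)
qed

lemma diag_op_basis: "diag_op b b' m (b j) = m j *\<^sub>R b' j"
proof -
  have "(\<lambda>k. (m k * (b j \<bullet> b k)) *\<^sub>R b' k) = (\<lambda>k. if k = j then m j *\<^sub>R b' j else 0)"
    by (auto simp: inner_basis)
  then show ?thesis
    using sums_unique[OF sums_single[of j "\<lambda>_. m j *\<^sub>R b' j"]] by (simp add: diag_op_eq)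
qed

lemma diag_op_diag_op:
  assumes "\<And>k. \<bar>m k\<bar> \<le> B"
  shows "diag_op b b' n (diag_op b b m w) = diag_op b b' (\<lambda>k. n k * m k) w"
  by (simp add: diag_op_eq[of b'] inner_diag_op[OF assms] mult.assoc)

lemma diag_op_sums:
  assumes "\<And>k. \<bar>m k\<bar> \<le> B"
  shows "(\<lambda>k. (m k * (w \<bullet> b k)) *\<^sub>R b k) sums diag_op b b m w"
  unfolding diag_op_eq by (rule series_sums[OF summable_diag[OF assms]])

lemma inner_diag_op_sums:
  assumes "\<And>k. \<bar>m k\<bar> \<le> B"
  shows "(\<lambda>k. m k * (v \<bullet> b k) * (w \<bullet> b k)) sums (diag_op b b m v \<bullet> w)"
  using bounded_linear.sums[OF bounded_linear_inner_left[of w] diag_op_sums[of m B v]] assms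
  by (simp add: inner_commute)

lemma diag_op_selfadjoint:
  assumes "\<And>k. \<bar>m k\<bar> \<le> B"
  shows "diag_op b b m v \<bullet> w = v \<bullet> diag_op b b m w"
proof (rule sums_unique2)
  show "(\<lambda>k. m k * (v \<bullet> b k) * (w \<bullet> b k)) sums (diag_op b b m v \<bullet> w)"
    by (rule inner_diag_op_sums[OF assms])
  show "(\<lambda>k. m k * (v \<bullet> b k) * (w \<bullet> b k)) sums (v \<bullet> diag_op b b m w)"
    using inner_diag_op_sums[of m B w v] assms
    by (simp add: inner_commute[of v] mult.commute mult.left_commute)
qed

lemma diag_op_nonneg:
  assumes "\<And>k. \<bar>m k\<bar> \<le> B" "\<And>k. 0 \<le> m k"
  shows "0 \<le> diag_op b b m v \<bullet> v"
  using assms(2) by (intro sums_le[OF _ sums_zero inner_diag_op_sums[OF assms(1)]]) (auto simp: mult.assoc)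

lemma scaleR_diag_op:
  assumes "\<And>k. \<bar>m k\<bar> \<le> B"
  shows "r *\<^sub>R diag_op b b m w = diag_op b b (\<lambda>k. r * m k) w"
  using sums_unique[OF sums_scaleR_right[OF diag_op_sums[of m B w], of r]] assms
  by (simp add: diag_op_eq mult.assoc)

end

text \<open>Since \<open>(R + c) (R - c) v = 0\<close>, the vector \<open>w = R v - c v\<close>
  satisfies \<open>R w = - c w\<close>, and positivity of \<open>R\<close> forces
  \<open>w = 0\<close> when \<open>c > 0\<close>. For \<open>c = 0\<close> self-adjointness gives
  that the squared norm of \<open>R v\<close> is the inner product of \<open>v\<close> with
  \<open>R (R v) = 0\<close>.\<close>

lemma positive_square_root_eigenvector:
  fixes R :: "'b::real_inner \<Rightarrow> 'b"
  assumes lin: "linear R" and sa: "\<And>x y. R x \<bullet> y = x \<bullet> R y" and pos: "\<And>x. 0 \<le> R x \<bullet> x"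
    and eig: "R (R v) = c\<^sup>2 *\<^sub>R v" and "0 \<le> c"
  shows "R v = c *\<^sub>R v"
proof (cases "c = 0")
  case True
  then have "R v \<bullet> R v = 0" using sa[of v "R v"] eig by simp
  then show ?thesis using True by simp
next
  case False
  interpret linear R by fact
  define w where "w = R v - c *\<^sub>R v"
  have "R w = - c *\<^sub>R w"
    by (simp add: w_def diff scale eig power2_eq_square algebra_simps)
  then have "0 \<le> - c * (w \<bullet> w)" using pos[of w] by simp
  then have "w \<bullet> w = 0"
    using False \<open>0 \<le> c\<close> by (smt (verit) inner_ge_zero mult_neg_pos)
  then show ?thesis by (simp add: w_def)
qed

text \<open>Uniqueness of the square root: a positive root acts as multiplication by \<open>c\<close> on the
  eigenvectors of its square for \<open>c\<^sup>2\<close>, and these span a dense subspace.\<close>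

lemma op_sqrt_eqI:
  fixes R :: "'b::{real_inner,banach} \<times> 'c::{real_inner,banach} \<Rightarrow> 'b \<times> 'c"
  assumes "orthonormal_basis b" "orthonormal_basis f"
    and R: "bounded_linear R" "\<And>x y. R x \<bullet> y = x \<bullet> R y" "\<And>x. 0 \<le> R x \<bullet> x" "R \<circ> R = C"
    and Rb: "\<And>k. R (b k, 0) = m k *\<^sub>R (b k, 0)" "\<And>k. R (0, f k) = n k *\<^sub>R (0, f k)"
    and nonneg: "\<And>k. 0 \<le> m k" "\<And>k. 0 \<le> n k"
  shows "op_sqrt C = R"
  unfolding op_sqrt_def
proof (rule the_equality)
  fix R'
  assume R': "bounded_linear R' \<and> (\<forall>x y. R' x \<bullet> y = x \<bullet> R' y) \<and> (\<forall>x. 0 \<le> R' x \<bullet> x) \<and> R' \<circ> R' = C"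
  interpret b: orthonormal_basis b by fact
  interpret f: orthonormal_basis f by fact
  interpret R: bounded_linear R by fact
  interpret R': bounded_linear R' using R' by blast
  have sq: "R' (R' v) = R (R v)" for v
    using R' R(4) by (metis comp_apply)
  have eigenvector: "R' v = c *\<^sub>R v" if "R v = c *\<^sub>R v" "0 \<le> c" for c v
  proof (rule positive_square_root_eigenvector[OF R'.linear_axioms _ _ _ that(2)])
    show "R' (R' v) = c\<^sup>2 *\<^sub>R v"
      by (simp add: sq that(1) R.scale power2_eq_square)
  qed (use R' in blast)+
  have eqb: "R' (b k, 0) = R (b k, 0)" "R' (0, f k) = R (0, f k)" for k
    using eigenvector[OF Rb(1) nonneg(1)] eigenvector[OF Rb(2) nonneg(2)] by (simp_all only: Rb)
  have p: "bounded_linear (\<lambda>p::'b. (p, 0::'c))" and w: "bounded_linear (\<lambda>w::'c. (0::'b, w))"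
    by (intro bounded_linear_Pair bounded_linear_ident bounded_linear_zero)+
  have "(\<lambda>p. R' (p, 0)) = (\<lambda>p. R (p, 0))"
    by (rule b.bounded_linear_eqI)
      (simp_all only: eqb bounded_linear_compose[OF R'.bounded_linear p] bounded_linear_compose[OF R.bounded_linear p])
  moreover have "(\<lambda>w. R' (0, w)) = (\<lambda>w. R (0, w))"
    by (rule f.bounded_linear_eqI)
      (simp_all only: eqb bounded_linear_compose[OF R'.bounded_linear w] bounded_linear_compose[OF R.bounded_linear w])
  \<comment> \<open>The bases live in the two factors, so the operators are compared on each factor
    separately and then added.\<close>
  moreover have "T z = T (fst z, 0) + T (0, snd z)" if "linear T" for T :: "'b \<times> 'c \<Rightarrow> 'b \<times> 'c" and z
    using linear_add[OF that, of "(fst z, 0)" "(0, snd z)"] by simp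
  ultimately show "R' = R"
    using R'.linear_axioms R.linear_axioms by (metis (no_types, lifting) ext)
qed (use R in auto)

text \<open>Two preimages of \<open>z\<close> that are orthogonal to the kernel differ by an element
  of the kernel that is orthogonal to itself. So any such preimage is the one selected by
  \<open>THE\<close>.\<close>

lemma pseudo_inverse_eq:
  fixes R :: "'b::real_inner \<Rightarrow> 'b"
  assumes "linear R" "R w = z" "\<And>v. R v = 0 \<Longrightarrow> w \<bullet> v = 0"
  shows "pseudo_inverse R z = w"
  unfolding pseudo_inverse_def
proof (rule the_equality)
  fix w' assume w': "R w' = z \<and> (\<forall>v. R v = 0 \<longrightarrow> w' \<bullet> v = 0)"
  interpret linear R by fact
  have "R (w' - w) = 0" using w' assms(2) by (simp add: diff)
  then have "w' \<bullet> (w' - w) = 0" "w \<bullet> (w' - w) = 0"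
    using w' assms(3) by auto
  then have "(w' - w) \<bullet> (w' - w) = 0" by (simp add: inner_diff_left)
  then show "w' = w" by simp
qed (use assms in auto)

section \<open>Square integrable controls\<close>

text \<open>Twice the cost of a control. Because of the open interval, controls that agree strictly
  between \<open>a\<close> and \<open>b\<close> have literally the same energy.\<close>

definition energy :: "real \<Rightarrow> real \<Rightarrow> (real \<Rightarrow> 'h::real_normed_vector) \<Rightarrow> real" where
  "energy a b \<psi> = (LINT s:{a<..<b}|lborel. (norm (\<psi> s))\<^sup>2)"

lemma energy_nonneg: "0 \<le> energy a b \<psi>"
  unfolding energy_def set_lebesgue_integral_def by (intro integral_nonneg_AE) simp

lemma energy_cong: "(\<And>s. a < s \<Longrightarrow> s < b \<Longrightarrow> \<psi> s = \<psi>' s) \<Longrightarrow> energy a b \<psi> = energy a b \<psi>'"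
  unfolding energy_def set_lebesgue_integral_def
  by (intro Bochner_Integration.integral_cong) (auto split: split_indicator)

lemma L2_controls_cong:
  assumes "\<And>s. a < s \<Longrightarrow> s < b \<Longrightarrow> \<psi> s = \<psi>' s" "\<psi> \<in> L2_controls a b"
  shows "\<psi>' \<in> L2_controls a b"
proof -
  have "(\<lambda>s. indicat_real {a<..<b} s *\<^sub>R \<psi>' s) = (\<lambda>s. indicat_real {a<..<b} s *\<^sub>R \<psi> s)"
    "(\<lambda>s. indicat_real {a<..<b} s *\<^sub>R (norm (\<psi>' s))\<^sup>2) = (\<lambda>s. indicat_real {a<..<b} s *\<^sub>R (norm (\<psi> s))\<^sup>2)"
    using assms(1) by (auto split: split_indicator)
  then show ?thesis
    using assms(2) by (simp add: L2_controls_def set_borel_measurable_def set_integrable_def)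
qed

lemma L2_controls_subset:
  fixes \<psi> :: "real \<Rightarrow> 'h::{banach,second_countable_topology}"
  assumes "\<psi> \<in> L2_controls a b" "a \<le> a'" "b' \<le> b"
  shows "\<psi> \<in> L2_controls a' b'"
proof -
  have "(\<lambda>s. indicat_real {a'<..<b'} s *\<^sub>R (indicat_real {a<..<b} s *\<^sub>R \<psi> s)) \<in> borel_measurable lborel"
    by (rule borel_measurable_scaleR)
      (use assms(1) in \<open>simp_all add: L2_controls_def set_borel_measurable_def\<close>)
  moreover have "(\<lambda>s. indicat_real {a'<..<b'} s *\<^sub>R (indicat_real {a<..<b} s *\<^sub>R \<psi> s)) =
      (\<lambda>s. indicat_real {a'<..<b'} s *\<^sub>R \<psi> s)"
    using assms by (auto simp: indicator_def)
  ultimately have "set_borel_measurable lborel {a'<..<b'} \<psi>"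
    unfolding set_borel_measurable_def by (simp only:)
  moreover have "set_integrable lborel {a'<..<b'} (\<lambda>s. (norm (\<psi> s))\<^sup>2)"
  proof (rule set_integrable_subset)
    show "set_integrable lborel {a<..<b} (\<lambda>s. (norm (\<psi> s))\<^sup>2)"
      using assms(1) by (simp add: L2_controls_def)
    show "{a'<..<b'} \<subseteq> {a<..<b}"
      using assms(2,3) by (intro subsetI) simp
  qed simp
  ultimately show ?thesis
    by (simp add: L2_controls_def)
qed

lemma energy_subset:
  fixes \<psi> :: "real \<Rightarrow> 'h::{banach,second_countable_topology}"
  assumes "\<psi> \<in> L2_controls a b" "a \<le> a'" "b' \<le> b"
  shows "energy a' b' \<psi> \<le> energy a b \<psi>"
  unfolding energy_def set_lebesgue_integral_def
proof (rule integral_mono)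
  show "integrable lborel (\<lambda>s. indicat_real {a<..<b} s *\<^sub>R (norm (\<psi> s))\<^sup>2)"
    "integrable lborel (\<lambda>s. indicat_real {a'<..<b'} s *\<^sub>R (norm (\<psi> s))\<^sup>2)"
    using assms L2_controls_subset[OF assms] by (auto simp: L2_controls_def set_integrable_def)
qed (use assms in \<open>auto split: split_indicator\<close>)

lemma L2_controls_join:
  fixes \<psi> :: "real \<Rightarrow> 'h::{banach,second_countable_topology}"
  assumes "\<psi> \<in> L2_controls a b" "\<psi> \<in> L2_controls b c" "a < b" "b < c"
  shows "\<psi> \<in> L2_controls a c"
proof -
  have [measurable]: "(\<lambda>s. indicat_real {a<..<b} s *\<^sub>R \<psi> s) \<in> borel_measurable lborel"
    "(\<lambda>s. indicat_real {b<..<c} s *\<^sub>R \<psi> s) \<in> borel_measurable lborel"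
    using assms by (auto simp: L2_controls_def set_borel_measurable_def)
  \<comment> \<open>Neither open interval contains \<open>b\<close>. The third summand restores the
    value there, so that the sum is exactly the cut-off of \<open>\<psi>\<close> to
    \<open>{a<..<c}\<close>.\<close>
  have "(\<lambda>s. indicat_real {a<..<b} s *\<^sub>R \<psi> s + indicat_real {b<..<c} s *\<^sub>R \<psi> s + indicat_real {b} s *\<^sub>R \<psi> b)
      \<in> borel_measurable lborel"
    by measurable
  moreover have "(\<lambda>s. indicat_real {a<..<b} s *\<^sub>R \<psi> s + indicat_real {b<..<c} s *\<^sub>R \<psi> s + indicat_real {b} s *\<^sub>R \<psi> b) =
      (\<lambda>s. indicat_real {a<..<c} s *\<^sub>R \<psi> s)"
    using assms(3,4) by (auto simp: indicator_def)
  ultimately have "set_borel_measurable lborel {a<..<c} \<psi>"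
    unfolding set_borel_measurable_def by (simp only:)
  moreover have "set_integrable lborel ({a<..<b} \<union> {b<..<c}) (\<lambda>s. (norm (\<psi> s))\<^sup>2)"
    using assms by (intro set_integrable_Un) (auto simp: L2_controls_def)
  then have "set_integrable lborel {a<..<c} (\<lambda>s. (norm (\<psi> s))\<^sup>2)"
    using set_integrable_discrete_difference[of "{b}" "{a<..<c}" "{a<..<b} \<union> {b<..<c}" lborel] assms(3,4)
    by fastforce
  ultimately show ?thesis
    by (simp add: L2_controls_def)
qed

lemma energy_join:
  fixes \<psi> :: "real \<Rightarrow> 'h::{banach,second_countable_topology}"
  assumes "\<psi> \<in> L2_controls a b" "\<psi> \<in> L2_controls b c" "a < b" "b < c"
  shows "energy a c \<psi> = energy a b \<psi> + energy b c \<psi>"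
proof -
  have "energy a c \<psi> = (LINT s:{a<..<b} \<union> {b<..<c}|lborel. (norm (\<psi> s))\<^sup>2)"
    unfolding energy_def
    by (rule set_integral_discrete_difference[where X = "{b}"]) (use assms(3,4) in auto)
  also have "\<dots> = energy a b \<psi> + energy b c \<psi>"
    unfolding energy_def using assms by (intro set_integral_Un) (auto simp: L2_controls_def)
  finally show ?thesis .
qed

lemma set_integral_shift:
  fixes f :: "real \<Rightarrow> 'b::{banach,second_countable_topology}"
  assumes "\<And>s. s \<in> A' \<longleftrightarrow> s + r \<in> A"
  shows "(LINT s:A'|lborel. f (s + r)) = (LINT s:A|lborel. f s)"
proof -
  have "(LINT s:A|lborel. f s) = (LINT s|lborel. indicator A (r + 1 * s) *\<^sub>R f (r + 1 * s))"
    unfolding set_lebesgue_integral_def by (subst lborel_integral_real_affine[of 1 _ r]) simp_all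
  also have "\<dots> = (LINT s:A'|lborel. f (s + r))"
    unfolding set_lebesgue_integral_def
    by (intro Bochner_Integration.integral_cong) (auto simp: assms indicator_def add.commute)
  finally show ?thesis ..
qed

lemma energy_shift: "energy (a - r) (b - r) (\<lambda>s. \<psi> (s + r)) = energy a b \<psi>"
  unfolding energy_def
  by (rule set_integral_shift[of _ r _ "\<lambda>s. (norm (\<psi> s))\<^sup>2"]) auto

lemma L2_controls_shift:
  assumes "\<psi> \<in> L2_controls a b"
  shows "(\<lambda>s. \<psi> (s + r)) \<in> L2_controls (a - r) (b - r)"
proof -
  have ind: "indicat_real {a - r<..<b - r} s = indicat_real {a<..<b} (r + 1 * s)" for s
    by (auto simp: indicator_def)
  have "(\<lambda>s. indicat_real {a<..<b} s *\<^sub>R \<psi> s) \<in> borel_measurable borel"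
    using assms by (simp add: L2_controls_def set_borel_measurable_def)
  then have "(\<lambda>s. indicat_real {a<..<b} (r + 1 * s) *\<^sub>R \<psi> (r + 1 * s)) \<in> borel_measurable borel"
    by (rule measurable_compose[rotated]) simp
  moreover have "integrable lborel (\<lambda>s. indicat_real {a<..<b} (r + 1 * s) *\<^sub>R (norm (\<psi> (r + 1 * s)))\<^sup>2)"
    using assms unfolding L2_controls_def set_integrable_def
    by (intro lborel_integrable_real_affine) auto
  ultimately show ?thesis
    unfolding L2_controls_def set_integrable_def set_borel_measurable_def ind
    by (simp add: add.commute)
qed

lemma set_integrable_Icc_iff:
  fixes f :: "real \<Rightarrow> 'b::{banach,second_countable_topology}"
  shows "set_integrable lborel {a..b} f \<longleftrightarrow> set_integrable lborel {a<..<b} f"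
  by (rule set_integrable_discrete_difference[where X = "{a, b}"]) auto

lemma set_integrable_bounded_linear:
  assumes "bounded_linear T" "set_integrable M A f"
  shows "set_integrable M A (\<lambda>s. T (f s))"
proof -
  interpret bounded_linear T by fact
  have "integrable M (\<lambda>s. T (indicator A s *\<^sub>R f s))"
    using assms(2) unfolding set_integrable_def by (rule integrable_bounded_linear[OF assms(1)])
  then show ?thesis
    by (simp add: set_integrable_def scale)
qed

text \<open>The interval is bounded, so the constant 1 is integrable on it, and
  \<open>1 + (norm (\<psi> s))\<^sup>2\<close> dominates \<open>norm (\<psi> s)\<close>.\<close>

lemma L2_controls_set_integrable:
  fixes \<psi> :: "real \<Rightarrow> 'h::{banach,second_countable_topology}"
  assumes "\<psi> \<in> L2_controls a b"
  shows "set_integrable lborel {a..b} \<psi>"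
  unfolding set_integrable_Icc_iff
proof (rule set_integrable_bound)
  have "set_integrable lborel {a<..<b} (\<lambda>_. 1::real)"
    by (rule set_integrable_subset[of _ "{a..b}"]) (auto intro!: borel_integrable_atLeastAtMost')
  then show "set_integrable lborel {a<..<b} (\<lambda>s. 1 + (norm (\<psi> s))\<^sup>2)"
    using assms by (intro set_integral_add) (auto simp: L2_controls_def)
  have "x \<le> 1 + x\<^sup>2" for x :: real
    using zero_le_power2[of "x - 1/2"] by (simp add: power2_diff algebra_simps power2_eq_square)
  then show "AE s in lborel. s \<in> {a<..<b} \<longrightarrow> norm (\<psi> s) \<le> norm (1 + (norm (\<psi> s))\<^sup>2)"
    by (intro AE_I2) (simp add: abs_of_nonneg)
qed (use assms in \<open>simp add: L2_controls_def\<close>)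

lemma continuous_imp_L2_controls:
  fixes \<psi> :: "real \<Rightarrow> 'h::{banach,second_countable_topology}"
  assumes "continuous_on {a..b} \<psi>"
  shows "\<psi> \<in> L2_controls a b"
proof -
  have "set_integrable lborel {a..b} \<psi>" "set_integrable lborel {a..b} (\<lambda>s. (norm (\<psi> s))\<^sup>2)"
    by (intro borel_integrable_atLeastAtMost' continuous_intros assms)+
  then have "set_integrable lborel {a<..<b} \<psi>" "set_integrable lborel {a<..<b} (\<lambda>s. (norm (\<psi> s))\<^sup>2)"
    by (simp_all only: set_integrable_Icc_iff)
  then show ?thesis
    by (auto simp: L2_controls_def set_borel_measurable_def set_integrable_def)
qed

lemma energy_le:
  assumes "\<psi> \<in> L2_controls a b" "a \<le> b" "\<And>s. s \<in> {a..b} \<Longrightarrow> (norm (\<psi> s))\<^sup>2 \<le> C"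
  shows "energy a b \<psi> \<le> (b - a) * C"
proof -
  have "energy a b \<psi> \<le> (LINT s:{a<..<b}|lborel. C)"
    unfolding energy_def
  proof (rule set_integral_mono)
    show "set_integrable lborel {a<..<b} (\<lambda>s. (norm (\<psi> s))\<^sup>2)"
      using assms(1) by (simp add: L2_controls_def)
    show "set_integrable lborel {a<..<b} (\<lambda>_. C)"
      using borel_integrable_atLeastAtMost'[of a b "\<lambda>_. C"] by (simp add: set_integrable_Icc_iff)
  qed (use assms(3) in simp)
  then show ?thesis using assms(2) by (simp add: set_integral_const)
qed

section \<open>Mild solutions and the rate functional\<close>

locale control_system = strongly_continuous_semigroup S
  for S :: "real \<Rightarrow> 'h::{real_inner,banach,second_countable_topology} \<times> 'g::{real_inner,banach,second_countable_topology} \<Rightarrow> 'h \<times> 'g" +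
  fixes \<iota> :: "'h \<Rightarrow> 'g" and Q DF :: "'h \<Rightarrow> 'h" and \<mu> :: real
  assumes \<iota>: "bounded_linear \<iota>" and Q: "bounded_linear Q" and DF: "continuous_on UNIV DF"
    and DF_0: "DF 0 = 0"
begin

abbreviation "mild \<equiv> mild_solution S \<iota> Q DF \<mu>"

lemma bounded_linear_Q_mu: "bounded_linear (Q_mu \<iota> Q \<mu>)"
  unfolding Q_mu_def[abs_def]
  by (intro bounded_linear_const_scaleR bounded_linear_Pair bounded_linear_zero
      bounded_linear_compose[OF \<iota>] Q)

lemma continuous_on_Q_mu: "continuous_on X f \<Longrightarrow> continuous_on X (\<lambda>s. Q_mu \<iota> Q \<mu> (f s))"
  by (rule bounded_linear.continuous_on[OF bounded_linear_Q_mu])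

lemma continuous_on_drift:
  "continuous_on X z \<Longrightarrow> continuous_on X (\<lambda>s. Q (DF (fst (z s))))"
  by (rule bounded_linear.continuous_on[OF Q continuous_on_compose2[OF DF continuous_on_fst]]) auto

text \<open>Control and nonlinear drift form one inhomogeneity, so that a mild solution is given by
  a single Duhamel integral, to which \<open>Duhamel_split\<close> applies.\<close>

definition forcing where
  "forcing z \<psi> s = Q_mu \<iota> Q \<mu> (\<psi> s - Q (DF (fst (z s))))"

lemma set_integrable_forcing:
  assumes "continuous_on {a..b} z" "\<psi> \<in> L2_controls a b"
  shows "set_integrable lborel {a..b} (forcing z \<psi>)"
  unfolding forcing_def[abs_def]
  by (intro set_integrable_bounded_linear[OF bounded_linear_Q_mu] set_integral_diff
      L2_controls_set_integrable assms borel_integrable_atLeastAtMost' continuous_on_drift)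

text \<open>The two integrals in \<open>mild_solution\<close> may be merged because both integrands
  are integrable: the control is square integrable on a bounded interval, and the drift is
  continuous along a continuous path.\<close>

lemma mild_iff:
  assumes "continuous_on {a..b} z" "\<psi> \<in> L2_controls a b"
  shows "mild a b z0 \<psi> z \<longleftrightarrow>
    (\<forall>t\<in>{a..b}. z t = S (t - a) z0 + (LINT s:{a..t}|lborel. S (t - s) (forcing z \<psi> s)))"
proof -
  have eq: "(LINT s:{a..t}|lborel. S (t - s) (forcing z \<psi> s)) =
      (LINT s:{a..t}|lborel. S (t - s) (Q_mu \<iota> Q \<mu> (\<psi> s))) -
      (LINT s:{a..t}|lborel. S (t - s) (Q_mu \<iota> Q \<mu> (Q (DF (fst (z s))))))" if "t \<in> {a..b}" for t
  proof -
    interpret B: bounded_linear "Q_mu \<iota> Q \<mu>" by (rule bounded_linear_Q_mu)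
    have "set_integrable lborel {a..t} \<psi>"
      by (rule L2_controls_set_integrable[OF L2_controls_subset[OF assms(2)]]) (use that in auto)
    moreover have "set_integrable lborel {a..t} (\<lambda>s. Q (DF (fst (z s))))"
      by (intro borel_integrable_atLeastAtMost' continuous_on_drift continuous_on_subset[OF assms(1)])
        (use that in auto)
    ultimately have "(LINT s:{a..t}|lborel. S (t - s) (Q_mu \<iota> Q \<mu> (\<psi> s)) - S (t - s) (Q_mu \<iota> Q \<mu> (Q (DF (fst (z s)))))) =
      (LINT s:{a..t}|lborel. S (t - s) (Q_mu \<iota> Q \<mu> (\<psi> s))) -
      (LINT s:{a..t}|lborel. S (t - s) (Q_mu \<iota> Q \<mu> (Q (DF (fst (z s))))))"
      by (intro set_integral_diff set_integrable_S set_integrable_bounded_linear[OF bounded_linear_Q_mu])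
    moreover have "S (t - s) (forcing z \<psi> s) =
        S (t - s) (Q_mu \<iota> Q \<mu> (\<psi> s)) - S (t - s) (Q_mu \<iota> Q \<mu> (Q (DF (fst (z s)))))"
      if "s \<in> {a..t}" for s
      using that linear_diff[OF bounded_linear.linear[OF bounded_linear_S[of "t - s"]]]
      by (simp add: forcing_def B.diff)
    then have "(LINT s:{a..t}|lborel. S (t - s) (forcing z \<psi> s)) =
        (LINT s:{a..t}|lborel. S (t - s) (Q_mu \<iota> Q \<mu> (\<psi> s)) - S (t - s) (Q_mu \<iota> Q \<mu> (Q (DF (fst (z s))))))"
      by (intro set_lebesgue_integral_cong) auto
    ultimately show ?thesis by simp
  qed
  have "z t = S (t - a) z0 - (LINT s:{a..t}|lborel. S (t - s) (Q_mu \<iota> Q \<mu> (Q (DF (fst (z s))))))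
        + (LINT s:{a..t}|lborel. S (t - s) (Q_mu \<iota> Q \<mu> (\<psi> s))) \<longleftrightarrow>
      z t = S (t - a) z0 + (LINT s:{a..t}|lborel. S (t - s) (forcing z \<psi> s))" if "t \<in> {a..b}" for t
    by (simp only: eq[OF that] add_diff_eq diff_add_eq)
  then show ?thesis
    using assms(1) unfolding mild_solution_def by (simp only: simp_thms cong: ball_cong)
qed

text \<open>The paths must agree up to the ends, but the controls only in the interior, since two
  points are negligible for the integrals. This leaves free which piece supplies the control at a
  junction.\<close>

lemma mild_cong:
  assumes "\<And>s. a \<le> s \<Longrightarrow> s \<le> b \<Longrightarrow> z s = z' s" "\<And>s. a < s \<Longrightarrow> s < b \<Longrightarrow> \<psi> s = \<psi>' s"
    and "mild a b z0 \<psi> z"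
  shows "mild a b z0 \<psi>' z'"
proof -
  have "continuous_on {a..b} z'"
    by (rule continuous_on_eq[of _ z]) (use assms(1,3) in \<open>auto simp: mild_solution_def\<close>)
  moreover have "(LINT s:{a..t}|lborel. S (t - s) (Q_mu \<iota> Q \<mu> (\<psi> s))) =
      (LINT s:{a..t}|lborel. S (t - s) (Q_mu \<iota> Q \<mu> (\<psi>' s)))" if "t \<in> {a..b}" for t
    unfolding set_lebesgue_integral_def
    by (rule integral_discrete_difference[where X = "{a, b}"])
      (use that assms(2) in \<open>auto simp: indicator_def\<close>)
  moreover have "(LINT s:{a..t}|lborel. S (t - s) (Q_mu \<iota> Q \<mu> (Q (DF (fst (z s)))))) =
      (LINT s:{a..t}|lborel. S (t - s) (Q_mu \<iota> Q \<mu> (Q (DF (fst (z' s))))))" if "t \<in> {a..b}" for t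
    by (rule set_lebesgue_integral_cong) (use assms(1) that in auto)
  moreover have "z' t = z t" if "t \<in> {a..b}" for t
    using assms(1) that by simp
  ultimately show ?thesis
    using assms(3) unfolding mild_solution_def by (simp only: simp_thms ball_triv cong: ball_cong)
qed

lemma mild_restrict:
  assumes "mild a c z0 \<psi> z" "\<psi> \<in> L2_controls a c" "a \<le> b" "b \<le> c"
  shows "mild b c (z b) \<psi> z"
proof -
  have cont: "continuous_on {a..c} z" using assms(1) by (simp add: mild_solution_def)
  note eq = bspec[OF assms(1)[unfolded mild_iff[OF cont assms(2)]]]
  have "z t = S (t - b) (z b) + (LINT s:{b..t}|lborel. S (t - s) (forcing z \<psi> s))"
    if t: "t \<in> {b..c}" for t
  proof -
    have int: "set_integrable lborel {a..t} (forcing z \<psi>)"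
      by (rule set_integrable_subset[OF set_integrable_forcing[OF cont assms(2)]]) (use t assms in auto)
    interpret bounded_linear "S (t - b)" using bounded_linear_S t by simp
    have zb: "z b = S (b - a) z0 + (LINT s:{a..b}|lborel. S (b - s) (forcing z \<psi> s))"
      by (rule eq) (use assms(3,4) in simp)
    have "z t = S (t - a) z0 + (LINT s:{a..t}|lborel. S (t - s) (forcing z \<psi> s))"
      by (rule eq) (use t assms(3) in simp)
    also have "\<dots> = S (t - b) (S (b - a) z0) + (S (t - b) (LINT s:{a..b}|lborel. S (b - s) (forcing z \<psi> s))
        + (LINT s:{b..t}|lborel. S (t - s) (forcing z \<psi> s)))"
    proof -
      have "S (t - a) z0 = S (t - b) (S (b - a) z0)"
        using S_add[of "t - b" "b - a" z0] t assms(3) by simp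
      then show ?thesis
        using Duhamel_split[OF int, of b] t assms(3) by simp
    qed
    also have "\<dots> = S (t - b) (z b) + (LINT s:{b..t}|lborel. S (t - s) (forcing z \<psi> s))"
      by (simp only: zb add add.assoc)
    finally show ?thesis .
  qed
  moreover have "continuous_on {b..c} z"
    by (rule continuous_on_subset[OF cont]) (use assms in auto)
  ultimately show ?thesis
    using mild_iff[OF _ L2_controls_subset[OF assms(2,3) order_refl]] by blast
qed

lemma mild_join:
  assumes "mild a b z0 \<psi> z" "mild b c (z b) \<psi> z" "\<psi> \<in> L2_controls a c" "a \<le> b" "b \<le> c"
  shows "mild a c z0 \<psi> z"
proof -
  have cont: "continuous_on {a..b} z" "continuous_on {b..c} z"
    using assms(1,2) by (simp_all add: mild_solution_def)
  then have "continuous_on ({a..b} \<union> {b..c}) z"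
    by (intro continuous_on_closed_Un) auto
  then have cont_ac: "continuous_on {a..c} z"
    using assms(4,5) by (simp add: ivl_disj_un)
  have L2: "\<psi> \<in> L2_controls a b" "\<psi> \<in> L2_controls b c"
    using L2_controls_subset[OF assms(3)] assms(4,5) by auto
  note eq1 = bspec[OF assms(1)[unfolded mild_iff[OF cont(1) L2(1)]]]
  note eq2 = bspec[OF assms(2)[unfolded mild_iff[OF cont(2) L2(2)]]]
  have "z t = S (t - a) z0 + (LINT s:{a..t}|lborel. S (t - s) (forcing z \<psi> s))"
    if t: "t \<in> {a..c}" for t
  proof (cases "t \<le> b")
    case True
    then show ?thesis using t by (intro eq1) simp
  next
    case False
    have int: "set_integrable lborel {a..t} (forcing z \<psi>)"
      by (rule set_integrable_subset[OF set_integrable_forcing[OF cont_ac assms(3)]]) (use t in auto)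
    interpret bounded_linear "S (t - b)" using bounded_linear_S False by simp
    have zb: "z b = S (b - a) z0 + (LINT s:{a..b}|lborel. S (b - s) (forcing z \<psi> s))"
      by (rule eq1) (use assms(4) in simp)
    have "z t = S (t - b) (z b) + (LINT s:{b..t}|lborel. S (t - s) (forcing z \<psi> s))"
      by (rule eq2) (use False t in simp)
    also have "\<dots> = S (t - b) (S (b - a) z0) + (S (t - b) (LINT s:{a..b}|lborel. S (b - s) (forcing z \<psi> s))
        + (LINT s:{b..t}|lborel. S (t - s) (forcing z \<psi> s)))"
      by (simp only: zb add add.assoc)
    also have "\<dots> = S (t - a) z0 + (LINT s:{a..t}|lborel. S (t - s) (forcing z \<psi> s))"
    proof -
      have "S (t - a) z0 = S (t - b) (S (b - a) z0)"
        using S_add[of "t - b" "b - a" z0] False assms(4) by simp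
      then show ?thesis
        using Duhamel_split[OF int, of b] False assms(4) by simp
    qed
    finally show ?thesis .
  qed
  then show ?thesis
    using mild_iff[OF cont_ac assms(3)] by blast
qed

lemma mild_shift:
  assumes "mild a b z0 \<psi> z"
  shows "mild (a - r) (b - r) z0 (\<lambda>s. \<psi> (s + r)) (\<lambda>s. z (s + r))"
proof -
  have "continuous_on {a - r..b - r} (\<lambda>s. z (s + r))"
    by (rule continuous_on_compose2[of "{a..b}" z])
      (use assms in \<open>auto intro!: continuous_intros simp: mild_solution_def\<close>)
  moreover have "(LINT s:{a - r..t}|lborel. S (t - s) (f (s + r))) =
      (LINT s:{a..t + r}|lborel. S (t + r - s) (f s))" for t and f :: "real \<Rightarrow> 'h \<times> 'g"
    using set_integral_shift[of "{a - r..t}" r "{a..t + r}" "\<lambda>s. S (t + r - s) (f s)"] by (simp add: algebra_simps)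
  note sh = this[of _ "\<lambda>s. Q_mu \<iota> Q \<mu> (\<psi> s)"] this[of _ "\<lambda>s. Q_mu \<iota> Q \<mu> (Q (DF (fst (z s))))"]
  have "z (t + r) = S (t - (a - r)) z0
        - (LINT s:{a - r..t}|lborel. S (t - s) (Q_mu \<iota> Q \<mu> (Q (DF (fst (z (s + r)))))))
        + (LINT s:{a - r..t}|lborel. S (t - s) (Q_mu \<iota> Q \<mu> (\<psi> (s + r))))"
    if "t \<in> {a - r..b - r}" for t
    using assms that by (simp add: mild_solution_def sh algebra_simps)
  ultimately show ?thesis
    by (simp add: mild_solution_def)
qed

lemma mild_zero: "mild a b 0 (\<lambda>_. 0) (\<lambda>_. 0)"
proof -
  interpret B: bounded_linear "Q_mu \<iota> Q \<mu>" by (rule bounded_linear_Q_mu)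
  interpret Q: bounded_linear Q by (rule Q)
  have "(LINT s:{a..t}|lborel. S (t - s) (Q_mu \<iota> Q \<mu> 0)) = 0" for t
    using set_lebesgue_integral_cong[of "{a..t}" lborel "\<lambda>s. S (t - s) (Q_mu \<iota> Q \<mu> 0)" "\<lambda>_. 0"]
    by (simp add: B.zero)
  then show ?thesis
    by (simp add: mild_solution_def DF_0 Q.zero)
qed

section \<open>Rate functionals of shifted, extended and concatenated paths\<close>

lemma rate_le:
  assumes "\<psi> \<in> L2_controls a b" "mild a b (z a) \<psi> z"
  shows "rate S \<iota> Q DF \<mu> a b z \<le> ennreal (1 / 2 * energy a b \<psi>)"
  unfolding rate_def energy_def by (rule INF_lower) (use assms in auto)

lemma rate_greatest:
  assumes "\<And>\<psi>. \<psi> \<in> L2_controls a b \<Longrightarrow> mild a b (z a) \<psi> z \<Longrightarrow> c \<le> ennreal (1 / 2 * energy a b \<psi>)"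
  shows "c \<le> rate S \<iota> Q DF \<mu> a b z"
  unfolding rate_def by (rule INF_greatest) (use assms in \<open>auto simp: energy_def\<close>)

text \<open>Each control for \<open>z\<close> on \<open>{0..T}\<close> yields one on
  \<open>{t..0}\<close> of no larger energy. For \<open>- T \<le> t\<close> it is shifted and
  restricted; otherwise it is shifted and preceded by the zero control, which keeps the path at
  0.\<close>

lemma rate_minus_infinity_extend_by_zero:
  assumes "0 < T" "z 0 = 0"
  shows "rate_minus_infinity S \<iota> Q DF \<mu> (\<lambda>t. if t \<le> - T then 0 else z (t + T)) \<le> rate S \<iota> Q DF \<mu> 0 T z"
    (is "rate_minus_infinity _ _ _ _ _ ?z \<le> _")
  unfolding rate_minus_infinity_def
proof (rule SUP_least, rule rate_greatest)
  fix t \<psi> assume "t \<in> {..<0::real}" and \<psi>: "\<psi> \<in> L2_controls 0 T" "mild 0 T (z 0) \<psi> z"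
  then have t: "t < 0" by simp
  define \<psi>' where "\<psi>' s = (if s \<le> - T then 0 else \<psi> (s + T))" for s
  have zT: "?z (- T) = 0" using assms by simp
  have L2: "\<psi>' \<in> L2_controls (- T) 0"
    using L2_controls_cong[OF _ L2_controls_shift[OF \<psi>(1), of T], of \<psi>'] by (simp add: \<psi>'_def)
  have "energy (- T) 0 \<psi>' = energy (0 - T) (T - T) (\<lambda>s. \<psi> (s + T))"
    using energy_cong[of "- T" 0 \<psi>' "\<lambda>s. \<psi> (s + T)"] by (simp add: \<psi>'_def)
  then have en: "energy (- T) 0 \<psi>' = energy 0 T \<psi>"
    by (simp only: energy_shift)
  have "mild (0 - T) (T - T) (z 0) (\<lambda>s. \<psi> (s + T)) (\<lambda>s. z (s + T))"
    by (rule mild_shift[OF \<psi>(2)])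
  then have mild: "mild (- T) 0 0 \<psi>' ?z"
    by (intro mild_cong[of "- T" 0 "\<lambda>s. z (s + T)" ?z "\<lambda>s. \<psi> (s + T)" \<psi>'])
      (auto simp: \<psi>'_def assms)
  show "rate S \<iota> Q DF \<mu> t 0 ?z \<le> ennreal (1 / 2 * energy 0 T \<psi>)"
  proof (cases "- T \<le> t")
    case True
    have "rate S \<iota> Q DF \<mu> t 0 ?z \<le> ennreal (1 / 2 * energy t 0 \<psi>')"
      by (rule rate_le) (use mild_restrict[OF mild L2] L2_controls_subset[OF L2] True t in auto)
    also have "\<dots> \<le> ennreal (1 / 2 * energy (- T) 0 \<psi>')"
      using energy_subset[OF L2 True] by (intro ennreal_leI) simp
    finally show ?thesis by (simp only: en)
  next
    case False
    have zero: "(\<lambda>_. 0) \<in> L2_controls t (- T)"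
      by (simp add: L2_controls_def set_borel_measurable_def set_integrable_def)
    have L2': "\<psi>' \<in> L2_controls t (- T)"
      by (rule L2_controls_cong[OF _ zero]) (simp add: \<psi>'_def)
    have mild': "mild t (- T) 0 \<psi>' ?z"
      by (rule mild_cong[OF _ _ mild_zero]) (auto simp: \<psi>'_def)
    have L2'': "\<psi>' \<in> L2_controls t 0"
      by (rule L2_controls_join[OF L2' L2]) (use False assms in auto)
    have "mild t 0 0 \<psi>' ?z"
      by (rule mild_join[OF mild' _ L2'']) (use mild zT False assms in auto)
    then have "rate S \<iota> Q DF \<mu> t 0 ?z \<le> ennreal (1 / 2 * energy t 0 \<psi>')"
      by (intro rate_le L2'') (use False in simp)
    also have "energy t 0 \<psi>' = energy t (- T) \<psi>' + energy (- T) 0 \<psi>'"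
      by (rule energy_join[OF L2' L2]) (use False assms in auto)
    also have "energy t (- T) \<psi>' = 0"
      using energy_cong[of t "- T" \<psi>' "\<lambda>_. 0"] by (simp add: \<psi>'_def energy_def)
    finally show ?thesis by (simp add: en)
  qed
qed

text \<open>The steering path \<open>w\<close> occupies \<open>{0..1}\<close> and is followed by
  \<open>z\<close>, moved from \<open>{t..0}\<close> to \<open>{1..1 - t}\<close>. The result is a
  competitor for the quasi-potential, and the costs of its two pieces add.\<close>

lemma quasi_potential_le:
  assumes \<phi>: "\<phi> \<in> L2_controls 0 1" "mild 0 1 0 \<phi> w" "w 0 = 0" "w 1 = z t" and "t < 0"
    and z: "z 0 = (x, y)"
  shows "quasi_potential S \<iota> Q DF \<mu> x y \<le> ennreal (1 / 2 * energy 0 1 \<phi>) + rate S \<iota> Q DF \<mu> t 0 z"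
proof -
  define c where "c = ennreal (1 / 2 * energy 0 1 \<phi>)"
  have c: "c \<noteq> top" by (simp add: c_def)
  \<comment> \<open>The finite cost \<open>c\<close> is moved to the left, so that the claim becomes
    a lower bound for \<open>rate\<close> and can be checked control by control.\<close>
  have "quasi_potential S \<iota> Q DF \<mu> x y - c \<le> rate S \<iota> Q DF \<mu> t 0 z"
  proof (rule rate_greatest)
    fix \<psi> assume \<psi>: "\<psi> \<in> L2_controls t 0" "mild t 0 (z t) \<psi> z"
    \<comment> \<open>Adding \<open>r\<close> takes the new time 1 to the old time \<open>t\<close>;
      the old time 0 becomes \<open>T = 1 - t\<close>.\<close>
    define r where "r = t - 1"
    define z' where "z' s = (if s \<le> 1 then w s else z (s + r))" for s
    define \<psi>' where "\<psi>' s = (if s \<le> 1 then \<phi> s else \<psi> (s + r))" for s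
    define T where "T = - r"
    have T: "1 < T" "t - r = 1" "0 - r = T" using \<open>t < 0\<close> by (simp_all add: T_def r_def)
    have L2a: "\<psi>' \<in> L2_controls 0 1"
      by (rule L2_controls_cong[OF _ \<phi>(1)]) (simp add: \<psi>'_def)
    have L2b: "\<psi>' \<in> L2_controls 1 T"
      by (rule L2_controls_cong[OF _ L2_controls_shift[OF \<psi>(1), of r, unfolded T]]) (simp add: \<psi>'_def)
    have L2: "\<psi>' \<in> L2_controls 0 T"
      by (rule L2_controls_join[OF L2a L2b]) (use T in auto)
    have ma: "mild 0 1 0 \<psi>' z'"
      by (rule mild_cong[OF _ _ \<phi>(2)]) (auto simp: z'_def \<psi>'_def)
    have mb: "mild 1 T (z t) \<psi>' z'"
      by (rule mild_cong[OF _ _ mild_shift[OF \<psi>(2), of r, unfolded T]])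
        (use \<phi>(4) in \<open>auto simp: z'_def \<psi>'_def r_def\<close>)
    have ends: "z' 0 = 0" "z' 1 = z t" "z' T = (x, y)"
      using \<phi> z T by (simp_all add: z'_def T_def)
    have m: "mild 0 T 0 \<psi>' z'"
      by (rule mild_join[OF ma _ L2]) (use mb ends T in auto)
    have "energy 0 T \<psi>' = energy 0 1 \<psi>' + energy 1 T \<psi>'"
      by (rule energy_join[OF L2a L2b]) (use T in auto)
    moreover have "energy 0 1 \<psi>' = energy 0 1 \<phi>"
      by (rule energy_cong) (simp add: \<psi>'_def)
    moreover have "energy 1 T \<psi>' = energy t 0 \<psi>"
      using energy_shift[of t r 0 \<psi>] T energy_cong[of 1 T \<psi>' "\<lambda>s. \<psi> (s + r)"]
      by (simp add: \<psi>'_def)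
    ultimately have en: "energy 0 T \<psi>' = energy 0 1 \<phi> + energy t 0 \<psi>" by simp
    have "quasi_potential S \<iota> Q DF \<mu> x y \<le> rate S \<iota> Q DF \<mu> 0 T z'"
      unfolding quasi_potential_def
      by (rule INF_lower2[of "(T, z')"]) (use m ends T in \<open>auto simp: mild_solution_def\<close>)
    also have "\<dots> \<le> ennreal (1 / 2 * energy 0 T \<psi>')"
      by (rule rate_le[OF L2]) (simp add: ends m)
    also have "\<dots> = ennreal (1 / 2 * energy 0 1 \<phi>) + ennreal (1 / 2 * energy t 0 \<psi>)"
      by (simp add: en ennreal_plus[symmetric] energy_nonneg add_divide_distrib del: ennreal_plus)
    finally show "quasi_potential S \<iota> Q DF \<mu> x y - c \<le> ennreal (1 / 2 * energy t 0 \<psi>)"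
      using c by (simp add: ennreal_minus_le_iff c_def)
  qed
  then show ?thesis
    using c by (simp add: ennreal_minus_le_iff c_def)
qed

end

section \<open>Steering the damped wave equation\<close>

text \<open>Pairing with a fixed vector \<open>v\<close> commutes with the integral and reduces the
  claim to the fundamental theorem for real functions; a vector is determined by its inner
  products.\<close>

lemma set_integral_FTC_inner:
  fixes H :: "real \<Rightarrow> 'b::{real_inner,banach,second_countable_topology}"
  assumes "a \<le> t" and der: "\<And>s. s \<in> {a..t} \<Longrightarrow> (H has_vector_derivative h s) (at s within {a..t})"
    and cont: "continuous_on {a..t} h"
  shows "(LINT s:{a..t}|lborel. h s) = H t - H a"
proof (rule vector_eq_ldot[THEN iffD1], rule allI)
  fix v
  have int: "integrable lborel (\<lambda>s. indicator {a..t} s *\<^sub>R h s)"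
    using borel_integrable_atLeastAtMost'[OF cont] by (simp add: set_integrable_def)
  have "v \<bullet> (LINT s:{a..t}|lborel. h s) = (LINT s|lborel. indicator {a..t} s *\<^sub>R (v \<bullet> h s))"
    unfolding set_lebesgue_integral_def
    using integral_bounded_linear[OF bounded_linear_inner_right int, of v] by simp
  also have "\<dots> = v \<bullet> H t - v \<bullet> H a"
  proof (rule integral_FTC_Icc[OF \<open>a \<le> t\<close>])
    fix s assume "a \<le> s" "s \<le> t"
    then show "((\<lambda>s. v \<bullet> H s) has_vector_derivative v \<bullet> h s) (at s within {a..t})"
      by (intro bounded_linear.has_vector_derivative[OF bounded_linear_inner_right] der) simp
  qed (intro continuous_intros cont)
  finally show "v \<bullet> (LINT s:{a..t}|lborel. h s) = v \<bullet> (H t - H a)"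
    by (simp add: inner_diff_right)
qed

locale damped_wave_system =
  fixes e :: "nat \<Rightarrow> 'h::{real_inner,banach,second_countable_topology}"
    and \<alpha> q :: "nat \<Rightarrow> real"
    and \<iota> :: "'h \<Rightarrow> 'g::{real_inner,banach,second_countable_topology}"
    and Q DF :: "'h \<Rightarrow> 'h" and \<kappa> \<mu> :: real
    and S :: "real \<Rightarrow> 'h \<times> 'g \<Rightarrow> 'h \<times> 'g"
  assumes e: "complete_orthonormal e"
    and \<alpha>_0: "0 < \<alpha> 0" and \<alpha>_mono: "\<And>k. \<alpha> k \<le> \<alpha> (Suc k)"
    and linear_\<iota>: "linear \<iota>" and norm_\<iota>: "\<And>u. (norm (\<iota> u))\<^sup>2 = Hdelta_sqnorm \<alpha> e (- 1) u"
    and dense_\<iota>: "closure (range \<iota>) = UNIV"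
    and bounded_Q: "bounded_linear Q" and Q_e: "\<And>k. Q (e k) = q k *\<^sub>R e k"
    and continuous_DF: "continuous_on UNIV DF" and DF_monotone: "\<And>u. 0 \<le> DF u \<bullet> u"
    and \<kappa>: "0 \<le> \<kappa>" and Lipschitz_DF: "\<And>u v. norm (DF u - DF v) \<le> \<kappa> * norm (u - v)"
    and \<mu>: "0 < \<mu>"
    and semigroup: "C0_semigroup S" and gen: "generator S = A_mu \<alpha> e \<iota> \<mu>"
begin

section \<open>The embedding of H into H^{-1} and an orthonormal basis of H^{-1}\<close>

sublocale e: orthonormal_basis e
  by unfold_locales (rule e)

lemma \<alpha>_ge: "\<alpha> 0 \<le> \<alpha> k"
  by (rule lift_Suc_mono_le[of \<alpha>]) (use \<alpha>_mono in auto)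

lemma \<alpha>_pos: "0 < \<alpha> k"
  using \<alpha>_0 \<alpha>_ge[of k] by linarith

lemma norm_\<iota>_eq: "(norm (\<iota> u))\<^sup>2 = (\<Sum>k. (u \<bullet> e k)\<^sup>2 / \<alpha> k)"
  using \<alpha>_pos by (simp add: norm_\<iota> Hdelta_sqnorm_def powr_minus less_imp_le divide_inverse mult.commute)

lemma summable_H_minus_1: "summable (\<lambda>k. (u \<bullet> e k)\<^sup>2 / \<alpha> k)"
proof (rule summable_comparison_test)
  show "summable (\<lambda>k. (u \<bullet> e k)\<^sup>2 / \<alpha> 0)"
    by (rule summable_divide[OF e.summable_coeffs])
  show "\<exists>N. \<forall>k\<ge>N. norm ((u \<bullet> e k)\<^sup>2 / \<alpha> k) \<le> (u \<bullet> e k)\<^sup>2 / \<alpha> 0"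
    using \<alpha>_pos \<alpha>_ge by (intro exI[of _ 0] allI impI) (simp add: frac_le less_imp_le)
qed

lemma norm_\<iota>_le: "norm (\<iota> u) \<le> norm u * (1 / sqrt (\<alpha> 0))"
proof (rule power2_le_imp_le)
  have "(norm (\<iota> u))\<^sup>2 \<le> (\<Sum>k. (u \<bullet> e k)\<^sup>2 / \<alpha> 0)"
    unfolding norm_\<iota>_eq
    by (rule suminf_le[OF _ summable_H_minus_1 summable_divide[OF e.summable_coeffs]])
      (use \<alpha>_pos \<alpha>_ge in \<open>simp add: frac_le less_imp_le\<close>)
  also have "\<dots> = (\<Sum>k. (u \<bullet> e k)\<^sup>2) / \<alpha> 0"
    by (rule suminf_divide[OF e.summable_coeffs])
  also have "\<dots> \<le> (norm u)\<^sup>2 / \<alpha> 0"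
    using e.Bessel[of u] \<alpha>_0 by (intro divide_right_mono) simp_all
  also have "\<dots> = (norm u * (1 / sqrt (\<alpha> 0)))\<^sup>2"
    using \<alpha>_0 by (simp add: power_mult_distrib power_divide)
  finally show "(norm (\<iota> u))\<^sup>2 \<le> (norm u * (1 / sqrt (\<alpha> 0)))\<^sup>2" .
qed (use \<alpha>_0 in simp)

lemma bounded_\<iota>: "bounded_linear \<iota>"
  unfolding bounded_linear_def bounded_linear_axioms_def
  using linear_\<iota> norm_\<iota>_le by blast

sublocale \<iota>: bounded_linear \<iota>
  by (rule bounded_\<iota>)

text \<open>Tested at \<open>- s d\<close> with \<open>d = DF 0\<close>, the sign condition makes
  the inner product of \<open>DF (- s d)\<close> and \<open>d\<close> nonpositive. The Lipschitz
  bound lets \<open>DF\<close> move by at most \<open>\<kappa> * s * norm d\<close> from its value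
  \<open>d\<close> at 0, which is too little because \<open>s\<close> is chosen with
  \<open>s * \<kappa> < 1\<close>.\<close>

lemma DF_0: "DF 0 = 0"
proof (rule ccontr)
  assume "DF 0 \<noteq> 0"
  define d where "d = DF 0"
  define s where "s = 1 / (2 * (\<kappa> + 1))"
  have s: "0 < s" "s * \<kappa> < 1"
    using \<kappa> by (auto simp: s_def field_simps)
  have d: "0 < d \<bullet> d" using \<open>DF 0 \<noteq> 0\<close> by (simp add: d_def)
  have "0 \<le> DF (- s *\<^sub>R d) \<bullet> (- s *\<^sub>R d)" by (rule DF_monotone)
  then have "DF (- s *\<^sub>R d) \<bullet> d \<le> 0"
    using s by (simp add: mult_le_0_iff)
  then have "d \<bullet> d \<le> (d - DF (- s *\<^sub>R d)) \<bullet> d"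
    by (simp add: inner_diff_left)
  also have "\<dots> \<le> norm (d - DF (- s *\<^sub>R d)) * norm d"
    by (rule norm_cauchy_schwarz)
  also have "\<dots> \<le> (\<kappa> * (s * norm d)) * norm d"
    using Lipschitz_DF[of 0 "- s *\<^sub>R d"] s by (intro mult_right_mono) (simp_all add: d_def)
  also have "\<dots> = (s * \<kappa>) * (d \<bullet> d)"
    by (simp add: power2_norm_eq_inner[symmetric] power2_eq_square)
  also have "\<dots> < d \<bullet> d"
    using s d by simp
  finally show False by simp
qed

sublocale control_system S \<iota> Q DF \<mu>
  by (intro control_system.intro control_system_axioms.intro strongly_continuous_semigroup.intro
      semigroup bounded_\<iota> bounded_Q continuous_DF DF_0)

text \<open>In H^{-1} the vector \<open>\<iota> (e k)\<close> has norm
  \<open>1 / sqrt (\<alpha> k)\<close>; this is its normalization.\<close>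

definition f :: "nat \<Rightarrow> 'g" where
  "f k = sqrt (\<alpha> k) *\<^sub>R \<iota> (e k)"

text \<open>The series formula is given for the norm of H^{-1} only, so orthogonality is obtained by
  polarization from \<open>\<iota> (e j + e k)\<close>.\<close>

lemma inner_\<iota>_e: "\<iota> (e j) \<bullet> \<iota> (e k) = (if j = k then 1 / \<alpha> k else 0)"
proof -
  have sq: "(norm (\<iota> (e k)))\<^sup>2 = 1 / \<alpha> k" for k
  proof -
    have "(\<lambda>i. (e k \<bullet> e i)\<^sup>2 / \<alpha> i) = (\<lambda>i. if i = k then 1 / \<alpha> i else 0)"
      by (auto simp: e.inner_basis)
    then show ?thesis
      using sums_unique[OF sums_single[of k "\<lambda>i. 1 / \<alpha> i"]] by (simp add: norm_\<iota>_eq)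
  qed
  have "\<iota> (e j) \<bullet> \<iota> (e k) = 0" if "j \<noteq> k"
  proof -
    have "(\<lambda>i. ((e j + e k) \<bullet> e i)\<^sup>2 / \<alpha> i) =
        (\<lambda>i. (if i = j then 1 / \<alpha> i else 0) + (if i = k then 1 / \<alpha> i else 0))"
      using that by (auto simp: e.inner_basis inner_add_left)
    then have "(norm (\<iota> (e j + e k)))\<^sup>2 = 1 / \<alpha> j + 1 / \<alpha> k"
      using sums_unique[OF sums_add[OF sums_single[of j "\<lambda>i. 1 / \<alpha> i"] sums_single[of k "\<lambda>i. 1 / \<alpha> i"]]]
      by (simp add: norm_\<iota>_eq)
    then show ?thesis
      using sq[of j] sq[of k]
      by (simp add: \<iota>.add power2_norm_eq_inner inner_add_left inner_add_right inner_commute)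
  qed
  then show ?thesis
    using sq[of k] by (simp add: power2_norm_eq_inner)
qed

text \<open>Completeness is inherited from \<open>e\<close>: continuity puts the whole range of
  \<open>\<iota>\<close> into the closed span of \<open>f\<close>, and that range is dense.\<close>

sublocale f: orthonormal_basis f
proof
  have "f j \<bullet> f k = (if j = k then 1 else 0)" for j k
    using \<alpha>_pos[of k] by (auto simp: f_def inner_\<iota>_e)
  moreover have "closure (span (range f)) = UNIV"
  proof -
    have "\<iota> (e k) = (1 / sqrt (\<alpha> k)) *\<^sub>R f k" for k
      using \<alpha>_pos[of k] by (simp add: f_def)
    then have "\<iota> (e k) \<in> span (range f)" for k
      by (metis rangeI span_base span_scale)
    then have "span (\<iota> ` range e) \<subseteq> span (range f)"
      by (intro span_minimal) auto
    then have "\<iota> ` span (range e) \<subseteq> closure (span (range f))"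
      using closure_subset[of "span (range f)"] by (simp add: linear_span_image[OF linear_\<iota>])
    then have "\<iota> ` closure (span (range e)) \<subseteq> closure (span (range f))"
      by (intro image_closure_subset linear_continuous_on bounded_\<iota>) auto
    then have "range \<iota> \<subseteq> closure (span (range f))"
      using e by (simp add: complete_orthonormal_def)
    then have "closure (range \<iota>) \<subseteq> closure (span (range f))"
      by (rule closure_minimal) simp
    then show ?thesis using dense_\<iota> by auto
  qed
  ultimately show "complete_orthonormal f"
    by (simp add: complete_orthonormal_def)
qed

text \<open>With the same basis on both sides, the quotient in \<open>diag_op\<close> makes each
  term invariant under rescaling of the basis vector.\<close>

lemma diag_op_\<iota>_e: "diag_op (\<iota> \<circ> e) (\<iota> \<circ> e) m = diag_op f f m"
proof
  fix w
  have "(m k * ((w \<bullet> \<iota> (e k)) / (\<iota> (e k) \<bullet> \<iota> (e k)))) *\<^sub>R \<iota> (e k) = (m k * (w \<bullet> f k)) *\<^sub>R f k" for k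
  proof -
    have "sqrt (\<alpha> k) * sqrt (\<alpha> k) = \<alpha> k" using \<alpha>_pos[of k] by simp
    then have "m k * (w \<bullet> \<iota> (e k) * \<alpha> k) = m k * (sqrt (\<alpha> k) * (w \<bullet> \<iota> (e k))) * sqrt (\<alpha> k)"
      by (metis (no_types, lifting) mult.assoc mult.commute)
    then show ?thesis
      by (simp add: inner_\<iota>_e f_def)
  qed
  then show "diag_op (\<iota> \<circ> e) (\<iota> \<circ> e) m w = diag_op f f m w"
    unfolding f.diag_op_eq by (simp add: diag_op_def)
qed

section \<open>The square root of the covariance \<open>C_mu\<close> and its pseudo-inverse\<close>

definition K where "K = onorm Q"

lemma K: "norm (Q u) \<le> K * norm u" "0 \<le> K" "\<bar>q k\<bar> \<le> K"
proof -
  show *: "norm (Q u) \<le> K * norm u" for u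
    unfolding K_def by (rule onorm[OF bounded_Q])
  show "0 \<le> K"
    unfolding K_def by (rule onorm_pos_le[OF bounded_Q])
  have "norm (e k) = 1"
    by (simp add: norm_eq_sqrt_inner e.inner_basis)
  then show "\<bar>q k\<bar> \<le> K"
    using *[of "e k"] by (simp add: Q_e)
qed

text \<open>Eigenvalues of the square root of \<open>C_mu\<close> along \<open>e k\<close>, and
  \<open>n k\<close> those along \<open>f k\<close>: the squares are
  \<open>(q k)\<^sup>2 / (2 * \<alpha> k)\<close> and
  \<open>(q k)\<^sup>2 / (2 * \<mu> * \<alpha> k)\<close>. The absolute value selects the
  nonnegative root, since \<open>q k\<close> may have either sign.\<close>

definition m where "m k = \<bar>q k\<bar> / sqrt (2 * \<alpha> k)"
definition n where "n k = \<bar>q k\<bar> / sqrt (2 * \<mu> * \<alpha> k)"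

lemma m_bound: "\<bar>m k\<bar> \<le> K / sqrt (2 * \<alpha> 0)"
  unfolding m_def using K \<alpha>_ge[of k] \<alpha>_0 \<alpha>_pos[of k] by (simp add: frac_le)

lemma n_bound: "\<bar>n k\<bar> \<le> K / sqrt (2 * \<mu> * \<alpha> 0)"
  unfolding n_def using K \<alpha>_ge[of k] \<alpha>_0 \<alpha>_pos[of k] \<mu> by (simp add: frac_le abs_mult)

lemma m_nonneg: "0 \<le> m k" and n_nonneg: "0 \<le> n k"
  using \<alpha>_pos[of k] \<mu> by (simp_all add: m_def n_def)

definition R :: "'h \<times> 'g \<Rightarrow> 'h \<times> 'g" where
  "R z = (diag_op e e m (fst z), diag_op f f n (snd z))"

lemma bounded_linear_R: "bounded_linear R"
  unfolding R_def[abs_def]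
  by (intro bounded_linear_Pair
      bounded_linear_compose[OF e.bounded_linear_diag_op[of m, OF m_bound] bounded_linear_fst]
      bounded_linear_compose[OF f.bounded_linear_diag_op[of n, OF n_bound] bounded_linear_snd])

sublocale R: bounded_linear R
  by (rule bounded_linear_R)

lemma op_sqrt_C_mu: "op_sqrt (C_mu \<alpha> e \<iota> q \<mu>) = R"
proof (rule op_sqrt_eqI[where m = m and n = n])
  show "orthonormal_basis e" "orthonormal_basis f" by unfold_locales
  show "R x \<bullet> y = x \<bullet> R y" for x y
    by (simp add: R_def inner_prod_def e.diag_op_selfadjoint[of m, OF m_bound] f.diag_op_selfadjoint[of n, OF n_bound])
  show "0 \<le> R x \<bullet> x" for x
    using e.diag_op_nonneg[of m, OF m_bound m_nonneg] f.diag_op_nonneg[of n, OF n_bound n_nonneg]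
    by (simp add: R_def inner_prod_def)
  have b: "\<bar>(q k)\<^sup>2 / \<alpha> k\<bar> \<le> K\<^sup>2 / \<alpha> 0" for k
  proof -
    have "(q k)\<^sup>2 \<le> K\<^sup>2"
      using power_mono[OF K(3)[of k] abs_ge_zero, of 2] by simp
    then show ?thesis
      using \<alpha>_ge[of k] \<alpha>_0 \<alpha>_pos[of k] by (simp add: frac_le)
  qed
  define M where "M k = (q k)\<^sup>2 / \<alpha> k" for k
  have M: "\<bar>M k\<bar> \<le> K\<^sup>2 / \<alpha> 0" for k
    unfolding M_def by (rule b)
  have "(\<lambda>k. 1 / 2 * M k) = (\<lambda>k. m k * m k)"
    using \<alpha>_pos by (auto simp: M_def m_def power2_eq_square[symmetric] power_divide less_imp_le)
  moreover have "(\<lambda>k. 1 / (2 * \<mu>) * M k) = (\<lambda>k. n k * n k)"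
    using \<alpha>_pos \<mu> by (auto simp: M_def n_def power2_eq_square[symmetric] power_divide less_imp_le mult.assoc)
  moreover have "C_mu \<alpha> e \<iota> q \<mu> z = ((1 / 2) *\<^sub>R diag_op e e M (fst z), (1 / (2 * \<mu>)) *\<^sub>R diag_op f f M (snd z))" for z
    by (simp add: C_mu_def diag_op_\<iota>_e M_def[abs_def])
  ultimately show "R \<circ> R = C_mu \<alpha> e \<iota> q \<mu>"
    by (intro ext) (simp only: comp_apply R_def fst_conv snd_conv e.scaleR_diag_op[of M, OF M]
        f.scaleR_diag_op[of M, OF M] e.diag_op_diag_op[of m, OF m_bound] f.diag_op_diag_op[of n, OF n_bound])
  show "R (e k, 0) = m k *\<^sub>R (e k, 0)" "R (0, f k) = n k *\<^sub>R (0, f k)" for k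
    by (simp_all add: R_def e.diag_op_basis f.diag_op_basis
        linear_0[OF bounded_linear.linear[OF e.bounded_linear_diag_op[of m, OF m_bound]]]
        linear_0[OF bounded_linear.linear[OF f.bounded_linear_diag_op[of n, OF n_bound]]])
  show "0 \<le> m k" "0 \<le> n k" for k
    by (rule m_nonneg n_nonneg)+
qed (rule bounded_linear_R)

text \<open>A preimage orthogonal to the kernel has to be exhibited before \<open>THE\<close> means
  anything. \<open>\<theta>\<close> projects an arbitrary preimage onto the modes with
  \<open>q k \<noteq> 0\<close>; this does not change its image, and the projection annihilates the
  kernel of \<open>R\<close>.\<close>

lemma R_pseudo_inverse:
  assumes "z \<in> range R"
  shows "R (pseudo_inverse R z) = z"
proof -
  define \<theta> :: "nat \<Rightarrow> real" where "\<theta> k = (if q k = 0 then 0 else 1)" for k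
  define P where "P w = (diag_op e e \<theta> (fst w), diag_op f f \<theta> (snd w))" for w
  have \<theta>: "\<bar>\<theta> k\<bar> \<le> 1" for k by (simp add: \<theta>_def)
  obtain w where w: "R w = z" using assms by blast
  have "(\<lambda>k. m k * \<theta> k) = m" "(\<lambda>k. n k * \<theta> k) = n"
    by (auto simp: m_def n_def \<theta>_def)
  then have RP: "R (P w) = z"
    by (simp add: w[symmetric] R_def P_def e.diag_op_diag_op[of \<theta>, OF \<theta>] f.diag_op_diag_op[of \<theta>, OF \<theta>])
  have "P w \<bullet> v = 0" if v: "R v = 0" for v
  proof -
    have "m k * (fst v \<bullet> e k) = 0" "n k * (snd v \<bullet> f k) = 0" for k
      using v e.inner_diag_op[of m _ "fst v" k, OF m_bound] f.inner_diag_op[of n _ "snd v" k, OF n_bound]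
      by (simp_all add: R_def zero_prod_def)
    then have "\<theta> k * (fst v \<bullet> e k) = 0" "\<theta> k * (snd v \<bullet> f k) = 0" for k
      using \<alpha>_pos \<mu> by (auto simp: m_def n_def \<theta>_def less_le)
    then have "diag_op e e \<theta> (fst v) = 0" "diag_op f f \<theta> (snd v) = 0"
      by (simp_all only: e.diag_op_eq f.diag_op_eq scaleR_zero_left suminf_zero)
    then show ?thesis
      by (simp add: P_def inner_prod_def e.diag_op_selfadjoint[of \<theta>, OF \<theta>] f.diag_op_selfadjoint[of \<theta>, OF \<theta>])
  qed
  then have "pseudo_inverse R z = P w"
    by (intro pseudo_inverse_eq R.linear_axioms RP)
  then show ?thesis using RP by simp
qed

lemma pseudo_inverse_0: "pseudo_inverse R 0 = 0"
  by (rule pseudo_inverse_eq) (simp_all add: R.linear_axioms R.zero)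

text \<open>\<open>(e k, 0)\<close> and \<open>(0, \<iota> (e k))\<close> span a plane in the domain of the generator, so a curve in this
  plane that solves the equation of the \<open>k\<close>-th mode can be differentiated along the semigroup.\<close>

lemma mode_has_vector_derivative:
  assumes u: "\<And>s. (u has_real_derivative v s) (at s)"
    and v: "\<And>s. (v has_real_derivative (q k * \<psi> s - \<alpha> k * u s - v s) / \<mu>) (at s)"
    and s: "s \<in> {0..t}"
  shows "((\<lambda>s. S (t - s) (u s *\<^sub>R e k, \<iota> (v s *\<^sub>R e k))) has_vector_derivative
    S (t - s) (Q_mu \<iota> Q \<mu> (\<psi> s *\<^sub>R e k))) (at s within {0..t})"
proof -
  define p1 :: "'h \<times> 'g" where "p1 = (e k, 0)"
  define p2 :: "'h \<times> 'g" where "p2 = (0, \<iota> (e k))"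
  have H1: "0 \<in> Hdelta \<alpha> e 1" "e k \<in> Hdelta \<alpha> e 1"
  proof -
    have "(\<lambda>i. \<alpha> i powr 1 * (e k \<bullet> e i)\<^sup>2) = (\<lambda>i. if i = k then \<alpha> i powr 1 else 0)"
      by (auto simp: e.inner_basis)
    then show "e k \<in> Hdelta \<alpha> e 1"
      using sums_summable[OF sums_single[of k "\<lambda>i. \<alpha> i powr 1"]] by (simp add: Hdelta_def)
  qed (simp add: Hdelta_def)
  have "(p1, (0, (1 / \<mu>) *\<^sub>R diag_op e (\<iota> \<circ> e) (\<lambda>k. - \<alpha> k) (e k) - (1 / \<mu>) *\<^sub>R \<iota> 0)) \<in> A_mu \<alpha> e \<iota> \<mu>"
    unfolding A_mu_def p1_def using H1 \<iota>.zero by (smt (verit) mem_Collect_eq)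
  moreover have "(0, (1 / \<mu>) *\<^sub>R diag_op e (\<iota> \<circ> e) (\<lambda>k. - \<alpha> k) (e k) - (1 / \<mu>) *\<^sub>R \<iota> 0) = (- (\<alpha> k / \<mu>)) *\<^sub>R p2"
    by (simp add: p2_def e.diag_op_basis \<iota>.zero)
  ultimately have g1: "(p1, (- (\<alpha> k / \<mu>)) *\<^sub>R p2) \<in> generator S"
    by (simp add: gen)
  have "(p2, (e k, (1 / \<mu>) *\<^sub>R diag_op e (\<iota> \<circ> e) (\<lambda>k. - \<alpha> k) 0 - (1 / \<mu>) *\<^sub>R \<iota> (e k))) \<in> A_mu \<alpha> e \<iota> \<mu>"
    unfolding A_mu_def p2_def using H1 by blast
  moreover have "(e k, (1 / \<mu>) *\<^sub>R diag_op e (\<iota> \<circ> e) (\<lambda>k. - \<alpha> k) 0 - (1 / \<mu>) *\<^sub>R \<iota> (e k)) = p1 - (1 / \<mu>) *\<^sub>R p2"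
    by (simp add: p1_def p2_def e.diag_op_eq)
  ultimately have g2: "(p2, p1 - (1 / \<mu>) *\<^sub>R p2) \<in> generator S"
    by (simp add: gen)
  have chain: "((\<lambda>s. S (t - s) x) has_vector_derivative - S (t - s) y) (at s within {0..t})"
    if "(x, y) \<in> generator S" for x y
  proof -
    have "((\<lambda>r. S r x) has_vector_derivative S (t - s) y) (at (t - s) within (\<lambda>s. t - s) ` {0..t})"
      by (rule has_vector_derivative_within_subset[OF S_has_vector_derivative[OF that]]) (use s in auto)
    moreover have "((\<lambda>s. t - s) has_vector_derivative - 1) (at s within {0..t})"
      by (auto intro!: derivative_eq_intros)
    ultimately have "((\<lambda>r. S r x) \<circ> (\<lambda>s. t - s) has_vector_derivative - 1 *\<^sub>R S (t - s) y) (at s within {0..t})"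
      by (intro vector_diff_chain_within)
    then show ?thesis by (simp add: comp_def)
  qed
  have lin: "S (t - r) (a *\<^sub>R x + b *\<^sub>R y) = a *\<^sub>R S (t - r) x + b *\<^sub>R S (t - r) y" if "r \<in> {0..t}" for r a b x y
    using bounded_linear_S[of "t - r"] that
    by (simp add: linear_add linear_scale bounded_linear.linear)
  define du dv where "du = v s" and "dv = (q k * \<psi> s - \<alpha> k * u s - v s) / \<mu>"
  \<comment> \<open>Differentiating the semigroup brings in the generator with a minus sign. The
    \<open>p1\<close> terms cancel because \<open>du = v s\<close>, and the elastic and damping
    terms combine with \<open>dv\<close> to leave the control term alone.\<close>
  have "((\<lambda>s. u s *\<^sub>R S (t - s) p1 + v s *\<^sub>R S (t - s) p2) has_vector_derivative
      (u s *\<^sub>R (- S (t - s) ((- (\<alpha> k / \<mu>)) *\<^sub>R p2)) + du *\<^sub>R S (t - s) p1) +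
      (v s *\<^sub>R (- S (t - s) (p1 - (1 / \<mu>) *\<^sub>R p2)) + dv *\<^sub>R S (t - s) p2)) (at s within {0..t})"
    unfolding du_def dv_def
    by (intro has_vector_derivative_add has_vector_derivative_scaleR chain g1 g2
        has_field_derivative_at_within[OF u] has_field_derivative_at_within[OF v])
  also have "(u s *\<^sub>R (- S (t - s) ((- (\<alpha> k / \<mu>)) *\<^sub>R p2)) + du *\<^sub>R S (t - s) p1) +
      (v s *\<^sub>R (- S (t - s) (p1 - (1 / \<mu>) *\<^sub>R p2)) + dv *\<^sub>R S (t - s) p2) = (q k * \<psi> s / \<mu>) *\<^sub>R S (t - s) p2"
  proof -
    have "S (t - s) ((- (\<alpha> k / \<mu>)) *\<^sub>R p2) = (- (\<alpha> k / \<mu>)) *\<^sub>R S (t - s) p2"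
      using lin[OF s, of "- (\<alpha> k / \<mu>)" p2 0 p2] by simp
    moreover have "S (t - s) (p1 - (1 / \<mu>) *\<^sub>R p2) = S (t - s) p1 - (1 / \<mu>) *\<^sub>R S (t - s) p2"
      using lin[OF s, of 1 p1 "- (1 / \<mu>)" p2] by simp
    moreover have "u s * (\<alpha> k / \<mu>) + v s / \<mu> + dv = q k * \<psi> s / \<mu>"
      using \<mu> by (simp add: dv_def field_simps)
    ultimately show ?thesis
      by (simp add: du_def scaleR_diff_right scaleR_add_left[symmetric])
  qed
  also have "(q k * \<psi> s / \<mu>) *\<^sub>R S (t - s) p2 = S (t - s) (Q_mu \<iota> Q \<mu> (\<psi> s *\<^sub>R e k))"
  proof -
    have "Q_mu \<iota> Q \<mu> (\<psi> s *\<^sub>R e k) = (q k * \<psi> s / \<mu>) *\<^sub>R p2"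
      by (simp add: Q_mu_def p2_def linear_scale[OF bounded_linear.linear[OF bounded_Q]] Q_e \<iota>.scaleR mult.commute)
    then show ?thesis
      using lin[OF s, of "q k * \<psi> s / \<mu>" p2 0 p2] by simp
  qed
  finally show ?thesis
  proof (rule has_vector_derivative_transform[OF s, rotated])
    fix r assume "r \<in> {0..t}"
    then show "S (t - r) (u r *\<^sub>R e k, \<iota> (v r *\<^sub>R e k)) = u r *\<^sub>R S (t - r) p1 + v r *\<^sub>R S (t - r) p2"
      by (simp add: lin[symmetric] p1_def p2_def \<iota>.scaleR)
  qed
qed

text \<open>The curve \<open>H\<close> runs from 0 at time 0, thanks to the initial values, to the
  state at time \<open>t\<close>, and its derivative is the integrand.\<close>

lemma modes_mild:
  assumes u: "\<And>k s. (u k has_real_derivative v k s) (at s)"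
    and v: "\<And>k s. (v k has_real_derivative (q k * \<psi> k s - \<alpha> k * u k s - v k s) / \<mu>) (at s)"
    and \<psi>: "\<And>k. continuous_on UNIV (\<psi> k)"
    and init: "\<And>k. u k 0 = 0" "\<And>k. v k 0 = 0" and "0 \<le> t"
  shows "(\<Sum>k<N. u k t *\<^sub>R e k, \<iota> (\<Sum>k<N. v k t *\<^sub>R e k)) =
    (LINT s:{0..t}|lborel. S (t - s) (Q_mu \<iota> Q \<mu> (\<Sum>k<N. \<psi> k s *\<^sub>R e k)))"
proof -
  interpret B: bounded_linear "Q_mu \<iota> Q \<mu>" by (rule bounded_linear_Q_mu)
  define H where "H s = (\<Sum>k<N. S (t - s) (u k s *\<^sub>R e k, \<iota> (v k s *\<^sub>R e k)))" for s
  have der: "(H has_vector_derivative S (t - s) (Q_mu \<iota> Q \<mu> (\<Sum>k<N. \<psi> k s *\<^sub>R e k))) (at s within {0..t})"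
    if s: "s \<in> {0..t}" for s
  proof -
    have "S (t - s) (Q_mu \<iota> Q \<mu> (\<Sum>k<N. \<psi> k s *\<^sub>R e k)) = (\<Sum>k<N. S (t - s) (Q_mu \<iota> Q \<mu> (\<psi> k s *\<^sub>R e k)))"
      using s by (simp add: B.sum linear_sum[OF bounded_linear.linear[OF bounded_linear_S]])
    then show ?thesis
      unfolding H_def
      by (auto intro!: has_vector_derivative_sum mode_has_vector_derivative u v s)
  qed
  have "continuous_on {0..t} (\<lambda>s. S (t - s) (Q_mu \<iota> Q \<mu> (\<Sum>k<N. \<psi> k s *\<^sub>R e k)))"
    by (intro continuous_on_S continuous_on_Q_mu continuous_intros continuous_on_subset[OF \<psi>]) auto
  then have "(LINT s:{0..t}|lborel. S (t - s) (Q_mu \<iota> Q \<mu> (\<Sum>k<N. \<psi> k s *\<^sub>R e k))) = H t - H 0"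
    by (intro set_integral_FTC_inner der \<open>0 \<le> t\<close>)
  moreover have "H 0 = 0"
    using \<open>0 \<le> t\<close> by (simp add: H_def init \<iota>.zero zero_prod_def[symmetric])
  moreover have "H t = (\<Sum>k<N. u k t *\<^sub>R e k, \<iota> (\<Sum>k<N. v k t *\<^sub>R e k))"
    by (simp add: H_def \<iota>.sum sum_prod)
  ultimately show ?thesis by simp
qed

text \<open>The limit of infinitely many modes in \<open>modes_mild\<close>: the square summable
  majorant \<open>B * g k\<close> gives uniform convergence, hence continuity, and a bound
  independent of \<open>N\<close> for dominated convergence in the Duhamel integral.\<close>

lemma modes_series_mild:
  assumes u: "\<And>k s. (u k has_real_derivative v k s) (at s)"
    and v: "\<And>k s. (v k has_real_derivative (q k * \<psi> k s - \<alpha> k * u k s - v k s) / \<mu>) (at s)"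
    and \<psi>: "\<And>k. continuous_on UNIV (\<psi> k)"
    and init: "\<And>k. u k 0 = 0" "\<And>k. v k 0 = 0"
    and bounds: "\<And>k s. s \<in> {0..1} \<Longrightarrow> \<bar>u k s\<bar> \<le> B * g k" "\<And>k s. s \<in> {0..1} \<Longrightarrow> \<bar>v k s\<bar> \<le> B * g k"
      "\<And>k s. s \<in> {0..1} \<Longrightarrow> \<bar>\<psi> k s\<bar> \<le> B * g k"
    and g: "summable (\<lambda>k. (g k)\<^sup>2)"
  defines "U \<equiv> \<lambda>s. \<Sum>k. u k s *\<^sub>R e k" and "V \<equiv> \<lambda>s. \<Sum>k. v k s *\<^sub>R e k" and "\<Psi> \<equiv> \<lambda>s. \<Sum>k. \<psi> k s *\<^sub>R e k"
  shows "continuous_on {0..1} U" "continuous_on {0..1} V" "continuous_on {0..1} \<Psi>"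
    "\<And>s. s \<in> {0..1} \<Longrightarrow> (norm (U s))\<^sup>2 \<le> B\<^sup>2 * (\<Sum>k. (g k)\<^sup>2)"
    "\<And>s. s \<in> {0..1} \<Longrightarrow> (norm (\<Psi> s))\<^sup>2 \<le> B\<^sup>2 * (\<Sum>k. (g k)\<^sup>2)"
    "\<And>t. t \<in> {0..1} \<Longrightarrow> (U t, \<iota> (V t)) = (LINT s:{0..t}|lborel. S (t - s) (Q_mu \<iota> Q \<mu> (\<Psi> s)))"
proof -
  interpret B: bounded_linear "Q_mu \<iota> Q \<mu>" by (rule bounded_linear_Q_mu)
  have g': "summable (\<lambda>k. (B * g k)\<^sup>2)"
    using summable_mult[OF g, of "B\<^sup>2"] by (simp add: power_mult_distrib)
  have lim: "uniform_limit {0..1} (\<lambda>N s. \<Sum>k<N. u k s *\<^sub>R e k) U sequentially"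
    "uniform_limit {0..1} (\<lambda>N s. \<Sum>k<N. v k s *\<^sub>R e k) V sequentially"
    "uniform_limit {0..1} (\<lambda>N s. \<Sum>k<N. \<psi> k s *\<^sub>R e k) \<Psi> sequentially"
    unfolding U_def V_def \<Psi>_def by (rule e.uniform_limit_series[OF bounds(1) g'] e.uniform_limit_series[OF bounds(2) g']
      e.uniform_limit_series[OF bounds(3) g'], assumption)+
  have cu: "continuous_on X (u k)" and cv: "continuous_on X (v k)" for X k
    using u v by (meson DERIV_continuous continuous_at_imp_continuous_on)+
  have c\<psi>: "continuous_on X (\<psi> k)" for X k
    by (rule continuous_on_subset[OF \<psi>]) simp
  show "continuous_on {0..1} U" "continuous_on {0..1} V" and \<Psi>: "continuous_on {0..1} \<Psi>"
    by (rule uniform_limit_theorem[OF always_eventually lim(1)] uniform_limit_theorem[OF always_eventually lim(2)]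
        uniform_limit_theorem[OF always_eventually lim(3)]; intro allI continuous_intros cu cv c\<psi> trivial_limit_sequentially)+
  show "(norm (U s))\<^sup>2 \<le> B\<^sup>2 * (\<Sum>k. (g k)\<^sup>2)" if "s \<in> {0..1}" for s
    unfolding U_def by (rule e.norm_series_le(2)[OF bounds(1)[OF that] g])
  show "(norm (\<Psi> s))\<^sup>2 \<le> B\<^sup>2 * (\<Sum>k. (g k)\<^sup>2)" if "s \<in> {0..1}" for s
    unfolding \<Psi>_def by (rule e.norm_series_le(2)[OF bounds(3)[OF that] g])
  fix t :: real assume t: "t \<in> {0..1}"
  \<comment> \<open>\<open>W\<close> bounds every partial sum of the control. With the bounds
    \<open>M\<close> for the semigroup and \<open>C\<close> for \<open>Q_mu\<close> it gives the
    constant majorant \<open>M * (W * C)\<close>.\<close>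
  define W where "W = sqrt (\<Sum>k. (B * g k)\<^sup>2)"
  have W: "norm (\<Sum>k<N. \<psi> k s *\<^sub>R e k) \<le> W" if "s \<in> {0..1}" for N s
  proof -
    have "(norm (\<Sum>k<N. \<psi> k s *\<^sub>R e k))\<^sup>2 = (\<Sum>k<N. (\<psi> k s)\<^sup>2)"
      by (simp add: e.norm_basis_sum)
    also have "\<dots> \<le> (\<Sum>k<N. (B * g k)\<^sup>2)"
    proof (rule sum_mono)
      fix k show "(\<psi> k s)\<^sup>2 \<le> (B * g k)\<^sup>2"
        using power_mono[OF bounds(3)[OF that, of k] abs_ge_zero, of 2] by simp
    qed
    also have "\<dots> \<le> (\<Sum>k. (B * g k)\<^sup>2)"
      by (rule sum_le_suminf[OF g']) auto
    finally show ?thesis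
      unfolding W_def by (rule real_le_rsqrt)
  qed
  obtain M where M: "M \<ge> 1" and bd: "\<And>s z. 0 \<le> s \<Longrightarrow> s \<le> 1 \<Longrightarrow> norm (S s z) \<le> M * norm z"
    using bounded_on_interval[of 1] by (metis atLeastAtMost_iff)
  obtain C where C: "C \<ge> 0" "\<And>z. norm (Q_mu \<iota> Q \<mu> z) \<le> norm z * C"
    using B.nonneg_bounded by blast
  have integrand: "(\<lambda>s. indicator {0..t} s *\<^sub>R S (t - s) (Q_mu \<iota> Q \<mu> (h s))) \<in> borel_measurable lborel"
    if "continuous_on {0..1} h" for h
  proof -
    have "continuous_on {0..t} (\<lambda>s. S (t - s) (Q_mu \<iota> Q \<mu> (h s)))"
      by (intro continuous_on_S continuous_on_Q_mu continuous_intros continuous_on_subset[OF that])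
        (use t in auto)
    from borel_integrable_atLeastAtMost'[OF this] show ?thesis
      by (auto simp: set_integrable_def)
  qed
  have "(\<lambda>N. LINT s:{0..t}|lborel. S (t - s) (Q_mu \<iota> Q \<mu> (\<Sum>k<N. \<psi> k s *\<^sub>R e k))) \<longlonglongrightarrow>
      (LINT s:{0..t}|lborel. S (t - s) (Q_mu \<iota> Q \<mu> (\<Psi> s)))"
    unfolding set_lebesgue_integral_def
  proof (rule integral_dominated_convergence[where w = "\<lambda>s. indicator {0..t} s *\<^sub>R (M * (W * C))"])
    show "(\<lambda>s. indicator {0..t} s *\<^sub>R S (t - s) (Q_mu \<iota> Q \<mu> (\<Psi> s))) \<in> borel_measurable lborel"
      by (rule integrand[OF \<Psi>])
    show "(\<lambda>s. indicator {0..t} s *\<^sub>R S (t - s) (Q_mu \<iota> Q \<mu> (\<Sum>k<N. \<psi> k s *\<^sub>R e k))) \<in> borel_measurable lborel" for N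
      by (rule integrand) (intro continuous_intros c\<psi>)
    show "integrable lborel (\<lambda>s. indicator {0..t} s *\<^sub>R (M * (W * C)))"
      using borel_integrable_atLeastAtMost'[of 0 t "\<lambda>_. M * (W * C)"] by (simp add: set_integrable_def)
    show "AE s in lborel. (\<lambda>N. indicator {0..t} s *\<^sub>R S (t - s) (Q_mu \<iota> Q \<mu> (\<Sum>k<N. \<psi> k s *\<^sub>R e k)))
        \<longlonglongrightarrow> indicator {0..t} s *\<^sub>R S (t - s) (Q_mu \<iota> Q \<mu> (\<Psi> s))"
    proof (rule AE_I2)
      fix s :: real
      show "(\<lambda>N. indicator {0..t} s *\<^sub>R S (t - s) (Q_mu \<iota> Q \<mu> (\<Sum>k<N. \<psi> k s *\<^sub>R e k)))
        \<longlonglongrightarrow> indicator {0..t} s *\<^sub>R S (t - s) (Q_mu \<iota> Q \<mu> (\<Psi> s))"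
      proof (cases "s \<in> {0..t}")
        case True
        then have "(\<lambda>N. \<Sum>k<N. \<psi> k s *\<^sub>R e k) \<longlonglongrightarrow> \<Psi> s"
          using t by (intro tendsto_uniform_limitI[OF lim(3)]) auto
        then show ?thesis
          using True by (intro tendsto_scaleR tendsto_const S_tendsto B.tendsto) auto
      qed simp
    qed
    show "AE s in lborel. norm (indicator {0..t} s *\<^sub>R S (t - s) (Q_mu \<iota> Q \<mu> (\<Sum>k<N. \<psi> k s *\<^sub>R e k)))
        \<le> indicator {0..t} s *\<^sub>R (M * (W * C))" for N
    proof (rule AE_I2)
      fix s :: real
      show "norm (indicator {0..t} s *\<^sub>R S (t - s) (Q_mu \<iota> Q \<mu> (\<Sum>k<N. \<psi> k s *\<^sub>R e k)))
        \<le> indicator {0..t} s *\<^sub>R (M * (W * C))"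
      proof (cases "s \<in> {0..t}")
        case True
        have "norm (S (t - s) (Q_mu \<iota> Q \<mu> (\<Sum>k<N. \<psi> k s *\<^sub>R e k))) \<le> M * norm (Q_mu \<iota> Q \<mu> (\<Sum>k<N. \<psi> k s *\<^sub>R e k))"
          using True t by (intro bd) auto
        also have "\<dots> \<le> M * (norm (\<Sum>k<N. \<psi> k s *\<^sub>R e k) * C)"
          using M by (intro mult_left_mono C(2)) simp
        also have "\<dots> \<le> M * (W * C)"
          using M C(1) True t by (intro mult_left_mono mult_right_mono W) auto
        finally show ?thesis using True by simp
      qed simp
    qed
  qed
  moreover have "(\<lambda>N. (\<Sum>k<N. u k t *\<^sub>R e k, \<iota> (\<Sum>k<N. v k t *\<^sub>R e k))) \<longlonglongrightarrow> (U t, \<iota> (V t))"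
    by (intro tendsto_Pair \<iota>.tendsto tendsto_uniform_limitI[OF lim(1) t] tendsto_uniform_limitI[OF lim(2) t])
  ultimately show "(U t, \<iota> (V t)) = (LINT s:{0..t}|lborel. S (t - s) (Q_mu \<iota> Q \<mu> (\<Psi> s)))"
    using modes_mild[OF u v \<psi> init] t by (intro LIMSEQ_unique) simp_all
qed

text \<open>The constants stem from \<open>\<bar>\<eta>\<bar> \<le> 5\<close>, \<open>\<bar>\<eta>'\<bar> \<le> 12\<close> and \<open>\<bar>\<eta>''\<bar> \<le> 18\<close> on \<open>[0, 1]\<close> for the cut-off \<open>\<eta>\<close> below.\<close>

definition "K\<^sub>U = (1 + K) * (12 / sqrt (2 * \<alpha> 0) + 5 / sqrt (2 * \<mu>))
  + (12 + 18 * \<mu>) / sqrt (2 * \<alpha> 0) + (5 + 24 * \<mu>) / sqrt (2 * \<mu>)"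

text \<open>The conservation of energy of the undamped oscillation \<open>\<phi>\<close> makes the cost of the control
  bounded uniformly in the mode \<open>k\<close>.\<close>

lemma mode_control:
  fixes a c :: real
  obtains u v \<psi> :: "real \<Rightarrow> real" where
    "\<And>s. (u has_real_derivative v s) (at s)"
    "\<And>s. (v has_real_derivative (q k * \<psi> s - \<alpha> k * u s - v s) / \<mu>) (at s)"
    "continuous_on UNIV \<psi>" "u 0 = 0" "v 0 = 0" "u 1 = m k * a" "v 1 = \<bar>q k\<bar> / sqrt (2 * \<mu>) * c"
    "\<And>s. s \<in> {0..1} \<Longrightarrow> \<bar>u s\<bar> \<le> K\<^sub>U * (\<bar>a\<bar> + \<bar>c\<bar>)"
    "\<And>s. s \<in> {0..1} \<Longrightarrow> \<bar>v s\<bar> \<le> K\<^sub>U * (\<bar>a\<bar> + \<bar>c\<bar>)"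
    "\<And>s. s \<in> {0..1} \<Longrightarrow> \<bar>\<psi> s\<bar> \<le> K\<^sub>U * (\<bar>a\<bar> + \<bar>c\<bar>)"
proof -
  define \<omega> where "\<omega> = sqrt (\<alpha> k / \<mu>)"
  define g where "g = \<bar>a\<bar> + \<bar>c\<bar>"
  \<comment> \<open>The cubic with \<open>\<eta> 0 = \<eta>1 0 = \<eta>1 1 = 0\<close> and
    \<open>\<eta> 1 = 1\<close>: the path starts at rest, and at time 1 position and velocity of the
    oscillation are left intact.\<close>
  define \<eta> \<eta>1 \<eta>2 :: "real \<Rightarrow> real"
    where "\<eta> s = 3 * s\<^sup>2 - 2 * s ^ 3" and "\<eta>1 s = 6 * s - 6 * s\<^sup>2" and "\<eta>2 s = 6 - 12 * s" for s
  \<comment> \<open>The phase is anchored at the final time, where \<open>\<phi>\<close> and its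
    derivative \<open>\<phi>1\<close> take the values \<open>a / sqrt (2 * \<alpha> k)\<close> and
    \<open>c / sqrt (2 * \<mu>)\<close>; times \<open>\<bar>q k\<bar>\<close> these are the
    prescribed end values.\<close>
  define \<phi> where "\<phi> s = (a * cos (\<omega> * (s - 1)) + c * sin (\<omega> * (s - 1))) / sqrt (2 * \<alpha> k)" for s
  define \<phi>1 where "\<phi>1 s = (c * cos (\<omega> * (s - 1)) - a * sin (\<omega> * (s - 1))) / sqrt (2 * \<mu>)" for s
  define u where "u s = \<bar>q k\<bar> * (\<eta> s * \<phi> s)" for s
  define v where "v s = \<bar>q k\<bar> * (\<eta>1 s * \<phi> s + \<eta> s * \<phi>1 s)" for s
  \<comment> \<open>Obtained by inserting \<open>u\<close> into
    \<open>q k * \<psi> = \<mu> * u'' + u' + \<alpha> k * u\<close>: the terms with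
    \<open>\<phi>''\<close> and \<open>\<alpha> k * \<phi>\<close> cancel, and
    \<open>\<bar>q k\<bar> / q k\<close> is the sign. If \<open>q k = 0\<close>, path and control
    both vanish.\<close>
  define \<psi> where "\<psi> s = sgn (q k) * (\<eta> s * \<phi>1 s + 2 * \<mu> * (\<eta>1 s * \<phi>1 s) + \<mu> * (\<eta>2 s * \<phi> s) + \<eta>1 s * \<phi> s)" for s
  have \<omega>: "\<omega> / sqrt (2 * \<alpha> k) = 1 / sqrt (2 * \<mu>)" "\<omega> / sqrt (2 * \<mu>) = \<alpha> k / \<mu> / sqrt (2 * \<alpha> k)"
  proof -
    have \<alpha>: "sqrt (\<alpha> k) * sqrt (\<alpha> k) = \<alpha> k" "sqrt (\<alpha> k) > 0" using \<alpha>_pos[of k] by simp_all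
    have m: "sqrt \<mu> * sqrt \<mu> = \<mu>" "sqrt \<mu> > 0" using \<mu> by simp_all
    show "\<omega> / sqrt (2 * \<alpha> k) = 1 / sqrt (2 * \<mu>)"
      using \<alpha>(2) m(2) by (simp add: \<omega>_def real_sqrt_divide real_sqrt_mult)
    have "\<omega> / sqrt (2 * \<mu>) = sqrt (\<alpha> k) / (sqrt 2 * (sqrt \<mu> * sqrt \<mu>))"
      by (simp add: \<omega>_def real_sqrt_divide real_sqrt_mult mult_ac)
    also have "\<dots> = (sqrt (\<alpha> k) * sqrt (\<alpha> k)) / \<mu> / (sqrt 2 * sqrt (\<alpha> k))"
    proof -
      have "r / (y * \<mu>) = (r * r) / \<mu> / (y * r)" if "0 < r" for r y :: real
        using that by simp
      from this[OF \<alpha>(2)] show ?thesis unfolding m(1) .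
    qed
    finally show "\<omega> / sqrt (2 * \<mu>) = \<alpha> k / \<mu> / sqrt (2 * \<alpha> k)"
      unfolding \<alpha>(1) by (simp only: real_sqrt_mult)
  qed
  have d\<eta>: "(\<eta> has_real_derivative \<eta>1 s) (at s)" "(\<eta>1 has_real_derivative \<eta>2 s) (at s)" for s
    unfolding \<eta>_def \<eta>1_def \<eta>2_def
    by (auto intro!: derivative_eq_intros simp: power2_eq_square)
  have d\<phi>: "(\<phi> has_real_derivative \<phi>1 s) (at s)" for s
  proof -
    have "(\<phi> has_real_derivative (c * cos (\<omega> * (s - 1)) - a * sin (\<omega> * (s - 1))) * (\<omega> / sqrt (2 * \<alpha> k))) (at s)"
      unfolding \<phi>_def times_divide_eq_right
      by (rule DERIV_cdivide) (auto intro!: derivative_eq_intros simp: algebra_simps)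
    then show ?thesis unfolding \<omega> \<phi>1_def by simp
  qed
  have d\<phi>1: "(\<phi>1 has_real_derivative - (\<alpha> k / \<mu>) * \<phi> s) (at s)" for s
  proof -
    have "(\<phi>1 has_real_derivative - (a * cos (\<omega> * (s - 1)) + c * sin (\<omega> * (s - 1))) * (\<omega> / sqrt (2 * \<mu>))) (at s)"
      unfolding \<phi>1_def times_divide_eq_right
      by (rule DERIV_cdivide) (auto intro!: derivative_eq_intros simp: algebra_simps)
    moreover have "- x * (y / z / r) = - (y / z) * (x / r)" for x y z r :: real by simp
    ultimately show ?thesis unfolding \<omega> \<phi>_def by metis
  qed
  have du: "(u has_real_derivative v s) (at s)" for s
    unfolding u_def v_def
    by (rule DERIV_cmult[THEN DERIV_cong] DERIV_mult d\<eta> d\<phi>)+ (simp add: algebra_simps)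
  have dv: "(v has_real_derivative (q k * \<psi> s - \<alpha> k * u s - v s) / \<mu>) (at s)" for s
  proof -
    have "(v has_real_derivative \<bar>q k\<bar> * ((\<eta>2 s * \<phi> s + \<phi>1 s * \<eta>1 s) +
        (\<eta>1 s * \<phi>1 s + - (\<alpha> k / \<mu>) * \<phi> s * \<eta> s))) (at s)"
      unfolding v_def by (intro DERIV_cmult DERIV_add DERIV_mult d\<eta> d\<phi> d\<phi>1)
    moreover have "q k * \<psi> s = \<bar>q k\<bar> * (\<eta> s * \<phi>1 s + 2 * \<mu> * (\<eta>1 s * \<phi>1 s) + \<mu> * (\<eta>2 s * \<phi> s) + \<eta>1 s * \<phi> s)"
      unfolding \<psi>_def mult.assoc[symmetric] by (simp only: abs_sgn)
    ultimately show ?thesis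
      using \<mu> by (simp add: u_def v_def field_simps)
  qed
  have cont: "continuous_on UNIV \<psi>"
    unfolding \<psi>_def \<eta>_def \<eta>1_def \<eta>2_def \<phi>_def \<phi>1_def by (intro continuous_intros) (use \<alpha>_pos[of k] \<mu> in auto)
  have ends: "u 0 = 0" "v 0 = 0" "u 1 = m k * a" "v 1 = \<bar>q k\<bar> / sqrt (2 * \<mu>) * c"
    by (simp_all add: u_def v_def \<eta>_def \<eta>1_def \<phi>_def \<phi>1_def m_def)
  have g: "0 \<le> g" by (simp add: g_def)
  have trig: "\<bar>x * cos r + y * sin r\<bar> \<le> \<bar>x\<bar> + \<bar>y\<bar>" for x y r :: real
  proof -
    have "\<bar>x * cos r\<bar> \<le> \<bar>x\<bar>" "\<bar>y * sin r\<bar> \<le> \<bar>y\<bar>"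
      by (simp_all add: abs_mult mult_left_le)
    then show ?thesis by linarith
  qed
  have b\<phi>: "\<bar>\<phi> s\<bar> \<le> 1 / sqrt (2 * \<alpha> 0) * g" for s
  proof -
    have "\<bar>\<phi> s\<bar> \<le> g / sqrt (2 * \<alpha> k)"
      using trig[of a "\<omega> * (s - 1)" c] \<alpha>_pos[of k]
      by (simp add: \<phi>_def g_def divide_right_mono)
    also have "\<dots> \<le> g / sqrt (2 * \<alpha> 0)"
      using g \<alpha>_0 \<alpha>_ge[of k] by (intro divide_left_mono) (simp_all add: \<alpha>_pos)
    finally show ?thesis by simp
  qed
  have b\<phi>1: "\<bar>\<phi>1 s\<bar> \<le> 1 / sqrt (2 * \<mu>) * g" for s
    using trig[of c "\<omega> * (s - 1)" "- a"] \<mu> by (simp add: \<phi>1_def g_def divide_right_mono add.commute)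
  \<comment> \<open>The triangle inequality alone gives 3 + 2, 6 + 6 and 6 + 12.\<close>
  have b\<eta>: "\<bar>\<eta> s\<bar> \<le> 5" "\<bar>\<eta>1 s\<bar> \<le> 12" "\<bar>\<eta>2 s\<bar> \<le> 18" if "s \<in> {0..1}" for s
  proof -
    have "0 \<le> s" "s \<le> 1" using that by auto
    then have "0 \<le> s\<^sup>2" "s\<^sup>2 \<le> 1" "0 \<le> s ^ 3" "s ^ 3 \<le> 1"
      by (simp_all add: power_le_one)
    then show "\<bar>\<eta> s\<bar> \<le> 5" "\<bar>\<eta>1 s\<bar> \<le> 12" "\<bar>\<eta>2 s\<bar> \<le> 18"
      using \<open>0 \<le> s\<close> \<open>s \<le> 1\<close> unfolding \<eta>_def \<eta>1_def \<eta>2_def by linarith+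
  qed
  define A where "A = 1 / sqrt (2 * \<alpha> 0) * g"
  define M where "M = 1 / sqrt (2 * \<mu>) * g"
  have AM: "0 \<le> A" "0 \<le> M" using g \<alpha>_0 \<mu> by (simp_all add: A_def M_def)
  \<comment> \<open>The summand with \<open>1 + K\<close> pays for \<open>u\<close> and
    \<open>v\<close>, the other two for \<open>\<psi>\<close>; a single constant serves all
    three.\<close>
  have KU: "K\<^sub>U * g = (1 + K) * (12 * A + 5 * M) + (12 + 18 * \<mu>) * A + (5 + 24 * \<mu>) * M"
    by (simp add: K\<^sub>U_def A_def M_def algebra_simps add_divide_distrib)
  have p: "\<bar>x * y\<bar> \<le> X * Y" if "\<bar>x\<bar> \<le> X" "\<bar>y\<bar> \<le> Y" for x y X Y :: real
    unfolding abs_mult using that by (intro mult_mono) auto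
  have bu: "\<bar>u s\<bar> \<le> K\<^sub>U * g" and bv: "\<bar>v s\<bar> \<le> K\<^sub>U * g" and b\<psi>: "\<bar>\<psi> s\<bar> \<le> K\<^sub>U * g" if s: "s \<in> {0..1}" for s
  proof -
    note b = b\<eta>[OF s] b\<phi>[of s, folded A_def] b\<phi>1[of s, folded M_def]
    have q: "\<bar>\<bar>q k\<bar>\<bar> \<le> 1 + K" using K(3)[of k] by simp
    have sg: "\<bar>sgn (q k)\<bar> \<le> 1" by (simp add: abs_sgn_eq)
    have nn: "0 \<le> K * A" "0 \<le> K * M" "0 \<le> \<mu> * A" "0 \<le> \<mu> * M"
      using AM K(2) \<mu> by simp_all
    have t: "\<bar>\<eta> s * \<phi> s\<bar> \<le> 5 * A" "\<bar>\<eta> s * \<phi>1 s\<bar> \<le> 5 * M" "\<bar>\<eta>1 s * \<phi> s\<bar> \<le> 12 * A"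
      "\<bar>\<eta>1 s * \<phi>1 s\<bar> \<le> 12 * M" "\<bar>\<eta>2 s * \<phi> s\<bar> \<le> 18 * A"
      by (intro p b)+
    have "\<bar>u s\<bar> \<le> (1 + K) * (5 * A)"
      unfolding u_def by (rule p[OF q t(1)])
    then show "\<bar>u s\<bar> \<le> K\<^sub>U * g"
      using nn AM unfolding KU by (simp add: algebra_simps)
    have "\<bar>v s\<bar> \<le> (1 + K) * (12 * A + 5 * M)"
      unfolding v_def by (rule p[OF q]) (use t in linarith)
    then show "\<bar>v s\<bar> \<le> K\<^sub>U * g"
      using nn AM unfolding KU by (simp add: algebra_simps)
    have m1: "\<bar>2 * \<mu> * (\<eta>1 s * \<phi>1 s)\<bar> \<le> 2 * \<mu> * (12 * M)" "\<bar>\<mu> * (\<eta>2 s * \<phi> s)\<bar> \<le> \<mu> * (18 * A)"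
      using \<mu> by (intro p t; simp)+
    have "\<bar>\<psi> s\<bar> \<le> 1 * (5 * M + 2 * \<mu> * (12 * M) + \<mu> * (18 * A) + 12 * A)"
      unfolding \<psi>_def by (rule p[OF sg]) (use t m1 in linarith)
    then show "\<bar>\<psi> s\<bar> \<le> K\<^sub>U * g"
      using nn AM unfolding KU by (simp add: algebra_simps)
  qed
  show thesis
    by (rule that[OF du dv cont ends]) (use bu bv b\<psi> in \<open>auto simp: g_def\<close>)
qed

text \<open>Since the constant of \<open>mode_control\<close> does not depend on the mode, Bessel's
  inequality sums the bounds to one by \<open>norm w\<close>. So every point in the range of
  \<open>R\<close>, the domain of \<open>C_mu^{-1/2}\<close>, is reachable from 0 in unit
  time.\<close>

lemma steering:
  "\<exists>C\<ge>0. \<forall>w. \<exists>\<psi>\<in>L2_controls 0 1. \<exists>z. mild 0 1 0 \<psi> z \<and> z 0 = 0 \<and> z 1 = R w \<and>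
    1 / 2 * energy 0 1 \<psi> \<le> C * (norm w)\<^sup>2"
proof (intro exI conjI allI)
  \<comment> \<open>Half the energy is at most
    \<open>K\<^sub>U\<^sup>2 * (1 + (K * \<kappa>)\<^sup>2)\<close> times the sum of all
    \<open>(g k)\<^sup>2\<close>, where 1 stands for the linear control and
    \<open>(K * \<kappa>)\<^sup>2\<close> for the drift; the factor 2 comes from
    \<open>sum_g\<close>.\<close>
  define C where "C = 2 * K\<^sub>U\<^sup>2 * (1 + (K * \<kappa>)\<^sup>2)"
  show "0 \<le> C" by (simp add: C_def)
  fix w :: "'h \<times> 'g"
  define a c where "a k = fst w \<bullet> e k" and "c k = snd w \<bullet> f k" for k
  define g where "g k = \<bar>a k\<bar> + \<bar>c k\<bar>" for k
  have "\<forall>k. \<exists>u v \<psi>. (\<forall>s. (u has_real_derivative v s) (at s)) \<and>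
    (\<forall>s. (v has_real_derivative (q k * \<psi> s - \<alpha> k * u s - v s) / \<mu>) (at s)) \<and>
    continuous_on UNIV \<psi> \<and> u 0 = 0 \<and> v 0 = 0 \<and> u 1 = m k * a k \<and> v 1 = \<bar>q k\<bar> / sqrt (2 * \<mu>) * c k \<and>
    (\<forall>s\<in>{0..1}. \<bar>u s\<bar> \<le> K\<^sub>U * g k \<and> \<bar>v s\<bar> \<le> K\<^sub>U * g k \<and> \<bar>\<psi> s\<bar> \<le> K\<^sub>U * g k)"
    unfolding g_def using mode_control by metis
  then obtain u v \<psi> where uv: "\<And>k s. (u k has_real_derivative v k s) (at s)"
    "\<And>k s. (v k has_real_derivative (q k * \<psi> k s - \<alpha> k * u k s - v k s) / \<mu>) (at s)"
    "\<And>k. continuous_on UNIV (\<psi> k)" "\<And>k. u k 0 = 0" "\<And>k. v k 0 = 0"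
    and final: "\<And>k. u k 1 = m k * a k" "\<And>k. v k 1 = \<bar>q k\<bar> / sqrt (2 * \<mu>) * c k"
    and bounds: "\<And>k s. s \<in> {0..1} \<Longrightarrow> \<bar>u k s\<bar> \<le> K\<^sub>U * g k"
    "\<And>k s. s \<in> {0..1} \<Longrightarrow> \<bar>v k s\<bar> \<le> K\<^sub>U * g k" "\<And>k s. s \<in> {0..1} \<Longrightarrow> \<bar>\<psi> k s\<bar> \<le> K\<^sub>U * g k"
    by metis
  have le: "(g k)\<^sup>2 \<le> 2 * ((a k)\<^sup>2 + (c k)\<^sup>2)" for k
    using zero_le_power2[of "\<bar>a k\<bar> - \<bar>c k\<bar>"] by (simp add: g_def power2_sum power2_diff)
  have sum2: "summable (\<lambda>k. 2 * ((a k)\<^sup>2 + (c k)\<^sup>2))"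
    unfolding a_def c_def by (intro summable_mult summable_add e.summable_coeffs f.summable_coeffs)
  have g: "summable (\<lambda>k. (g k)\<^sup>2)"
    by (rule summable_comparison_test[OF _ sum2]) (use le in auto)
  have "(\<Sum>k. (g k)\<^sup>2) \<le> (\<Sum>k. 2 * ((a k)\<^sup>2 + (c k)\<^sup>2))"
    by (rule suminf_le[OF le g sum2])
  also have "\<dots> = 2 * ((\<Sum>k. (a k)\<^sup>2) + (\<Sum>k. (c k)\<^sup>2))"
    unfolding a_def c_def
    by (simp only: suminf_mult suminf_add summable_add e.summable_coeffs f.summable_coeffs)
  also have "\<dots> \<le> 2 * ((norm (fst w))\<^sup>2 + (norm (snd w))\<^sup>2)"
    unfolding a_def c_def by (intro mult_left_mono add_mono e.Bessel f.Bessel) simp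
  finally have sum_g: "(\<Sum>k. (g k)\<^sup>2) \<le> 2 * (norm w)\<^sup>2"
    by (simp add: norm_prod_def)
  define U V \<Psi> where "U = (\<lambda>s. \<Sum>k. u k s *\<^sub>R e k)" and "V = (\<lambda>s. \<Sum>k. v k s *\<^sub>R e k)"
    and "\<Psi> = (\<lambda>s. \<Sum>k. \<psi> k s *\<^sub>R e k)"
  have series: "continuous_on {0..1} U" "continuous_on {0..1} V" "continuous_on {0..1} \<Psi>"
    "\<And>s. s \<in> {0..1} \<Longrightarrow> (norm (U s))\<^sup>2 \<le> K\<^sub>U\<^sup>2 * (\<Sum>k. (g k)\<^sup>2)"
    "\<And>s. s \<in> {0..1} \<Longrightarrow> (norm (\<Psi> s))\<^sup>2 \<le> K\<^sub>U\<^sup>2 * (\<Sum>k. (g k)\<^sup>2)"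
    "\<And>t. t \<in> {0..1} \<Longrightarrow> (U t, \<iota> (V t)) = (LINT s:{0..t}|lborel. S (t - s) (Q_mu \<iota> Q \<mu> (\<Psi> s)))"
    unfolding U_def V_def \<Psi>_def by (rule modes_series_mild[OF uv bounds g]; assumption)+
  define z where "z s = (U s, \<iota> (V s))" for s
  define \<psi>' where "\<psi>' s = \<Psi> s + Q (DF (fst (z s)))" for s
  have cz: "continuous_on {0..1} z"
    unfolding z_def by (intro continuous_on_Pair series bounded_linear.continuous_on[OF bounded_\<iota>])
  have "continuous_on {0..1} \<psi>'"
    unfolding \<psi>'_def by (intro continuous_on_add series continuous_on_drift cz)
  then have L2: "\<psi>' \<in> L2_controls 0 1"
    by (rule continuous_imp_L2_controls)
  have "forcing z \<psi>' s = Q_mu \<iota> Q \<mu> (\<Psi> s)" for s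
    by (simp add: forcing_def \<psi>'_def)
  then have mild: "mild 0 1 0 \<psi>' z"
    unfolding mild_iff[OF cz L2] using series(6) by (simp add: z_def)
  have z0: "z 0 = 0"
    by (simp add: z_def U_def V_def uv \<iota>.zero zero_prod_def)
  have "z 1 = R w"
  proof -
    have s: "summable (\<lambda>k. (n k * c k)\<^sup>2)"
      unfolding c_def by (rule f.summable_diag[OF n_bound])
    have sv: "summable (\<lambda>k. (v k 1)\<^sup>2)"
      by (rule e.norm_series_le(1)[OF bounds(2) g]) simp
    \<comment> \<open>The velocity is expanded along \<open>e\<close>, while \<open>R\<close> acts
      along the normalized \<open>f\<close>; the factor \<open>sqrt (\<alpha> k)\<close> in
      \<open>f k\<close> turns one coefficient into the other.\<close>
    have "v k 1 *\<^sub>R \<iota> (e k) = (n k * c k) *\<^sub>R f k" for k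
    proof -
      have "\<bar>q k\<bar> / sqrt (2 * \<mu>) = n k * sqrt (\<alpha> k)"
        using \<alpha>_pos[of k] by (simp add: n_def real_sqrt_mult)
      then show ?thesis by (simp add: final f_def)
    qed
    then have "\<iota> (V 1) = (\<Sum>k. (n k * c k) *\<^sub>R f k)"
      using sums_unique[OF \<iota>.sums[OF e.series_sums[OF sv]]] by (simp add: V_def \<iota>.scaleR)
    then show ?thesis
      by (simp add: z_def R_def e.diag_op_eq f.diag_op_eq U_def final a_def c_def)
  qed
  have "1 / 2 * energy 0 1 \<psi>' \<le> C * (norm w)\<^sup>2"
  proof -
    define G where "G = K\<^sub>U\<^sup>2 * (\<Sum>k. (g k)\<^sup>2)"
    have "(norm (\<psi>' s))\<^sup>2 \<le> 2 * G + 2 * ((K * \<kappa>)\<^sup>2 * G)" if s: "s \<in> {0..1}" for s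
    proof -
      have "norm (Q (DF (U s))) \<le> K * norm (DF (U s))" by (rule K(1))
      also have "\<dots> \<le> K * (\<kappa> * norm (U s))"
        using Lipschitz_DF[of "U s" 0] by (intro mult_left_mono K(2)) (simp add: DF_0)
      finally have "(norm (Q (DF (U s))))\<^sup>2 \<le> (K * \<kappa> * norm (U s))\<^sup>2"
        by (intro power_mono) (simp_all add: mult.assoc)
      also have "\<dots> \<le> (K * \<kappa>)\<^sup>2 * G"
        unfolding power_mult_distrib[of "K * \<kappa>"] G_def by (intro mult_left_mono series(4)[OF s]) simp
      finally have Q: "(norm (Q (DF (U s))))\<^sup>2 \<le> (K * \<kappa>)\<^sup>2 * G" .
      have "(norm (\<psi>' s))\<^sup>2 \<le> (norm (\<Psi> s) + norm (Q (DF (U s))))\<^sup>2"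
        by (intro power_mono) (simp_all add: \<psi>'_def z_def norm_triangle_ineq)
      also have "\<dots> \<le> 2 * (norm (\<Psi> s))\<^sup>2 + 2 * (norm (Q (DF (U s))))\<^sup>2"
        using zero_le_power2[of "norm (\<Psi> s) - norm (Q (DF (U s)))"]
        by (simp add: power2_sum power2_diff)
      also have "\<dots> \<le> 2 * G + 2 * ((K * \<kappa>)\<^sup>2 * G)"
        using series(5)[OF s] Q unfolding G_def by linarith
      finally show ?thesis .
    qed
    then have "energy 0 1 \<psi>' \<le> 2 * G + 2 * ((K * \<kappa>)\<^sup>2 * G)"
      using energy_le[OF L2] by simp
    then have "1 / 2 * energy 0 1 \<psi>' \<le> K\<^sub>U\<^sup>2 * (1 + (K * \<kappa>)\<^sup>2) * (\<Sum>k. (g k)\<^sup>2)"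
      by (simp add: G_def algebra_simps)
    also have "\<dots> \<le> K\<^sub>U\<^sup>2 * (1 + (K * \<kappa>)\<^sup>2) * (2 * (norm w)\<^sup>2)"
      by (intro mult_left_mono sum_g) simp
    finally show ?thesis by (simp add: C_def algebra_simps)
  qed
  then show "\<exists>\<psi>\<in>L2_controls 0 1. \<exists>z. mild 0 1 0 \<psi> z \<and> z 0 = 0 \<and> z 1 = R w \<and>
      1 / 2 * energy 0 1 \<psi> \<le> C * (norm w)\<^sup>2"
    using L2 mild z0 \<open>z 1 = R w\<close> by blast
qed

section \<open>Comparison of the two variational problems\<close>

lemma quasi_potential_eq:
  "quasi_potential S \<iota> Q DF \<mu> x y =
    (INF z \<in> {z. continuous_on {..0} z \<and> z 0 = (x, y) \<and> (\<forall>\<^sub>F t in at_bot. z t \<in> range R) \<and>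
        ((\<lambda>t. norm (pseudo_inverse R (z t))) \<longlongrightarrow> 0) at_bot}.
      rate_minus_infinity S \<iota> Q DF \<mu> z)" (is "?V = (INF z \<in> ?Z. ?I z)")
proof (rule antisym)
  show "?V \<le> (INF z \<in> ?Z. ?I z)"
  proof (rule INF_greatest)
    fix z assume "z \<in> ?Z"
    then have z: "z 0 = (x, y)" and ev: "\<forall>\<^sub>F t in at_bot. z t \<in> range R"
      and lim: "((\<lambda>t. norm (pseudo_inverse R (z t))) \<longlongrightarrow> 0) at_bot"
      by auto
    obtain C where C: "C \<ge> 0" "\<And>w. \<exists>\<psi>\<in>L2_controls 0 1. \<exists>z. mild 0 1 0 \<psi> z \<and> z 0 = 0 \<and> z 1 = R w \<and>
        1 / 2 * energy 0 1 \<psi> \<le> C * (norm w)\<^sup>2"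
      using steering by blast
    \<comment> \<open>For every very negative \<open>t\<close> this bounds the quasi-potential from
      above, and its first summand tends to 0. The limit is taken in \<open>ennreal\<close>, so the
      second summand may be infinite.\<close>
    define h where "h t = ennreal (C * (norm (pseudo_inverse R (z t)))\<^sup>2) + ?I z" for t
    have "((\<lambda>t. C * (norm (pseudo_inverse R (z t)))\<^sup>2) \<longlongrightarrow> C * 0\<^sup>2) at_bot"
      by (intro tendsto_intros lim)
    then have "(h \<longlongrightarrow> ennreal (C * 0\<^sup>2) + ?I z) at_bot"
      unfolding h_def by (intro tendsto_add tendsto_ennrealI tendsto_const)
    then have "(h \<longlongrightarrow> ?I z) at_bot" by simp
    moreover have "\<forall>\<^sub>F t in at_bot. ?V \<le> h t"
      using ev eventually_gt_at_bot[of "0::real"]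
    proof eventually_elim
      case (elim t)
      define w where "w = pseudo_inverse R (z t)"
      obtain \<psi> z' where \<psi>: "\<psi> \<in> L2_controls 0 1" "mild 0 1 0 \<psi> z'" "z' 0 = 0" "z' 1 = R w"
        "1 / 2 * energy 0 1 \<psi> \<le> C * (norm w)\<^sup>2"
        using C(2)[of w] by blast
      have "z' 1 = z t"
        using \<psi>(4) R_pseudo_inverse[OF elim(1)] by (simp add: w_def)
      from quasi_potential_le[of _ z' z, OF \<psi>(1-3) this elim(2) z]
      have "?V \<le> ennreal (1 / 2 * energy 0 1 \<psi>) + rate S \<iota> Q DF \<mu> t 0 z" .
      also have "\<dots> \<le> ennreal (C * (norm w)\<^sup>2) + ?I z"
        unfolding rate_minus_infinity_def
        by (intro add_mono ennreal_leI \<psi>(5) SUP_upper) (use elim(2) in simp)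
      finally show ?case by (simp add: h_def w_def)
    qed
    ultimately show "?V \<le> ?I z"
      by (rule tendsto_lowerbound[OF _ _ trivial_limit_at_bot_linorder])
  qed
  show "(INF z \<in> ?Z. ?I z) \<le> ?V"
    unfolding quasi_potential_def
  proof (rule INF_greatest, clarify)
    fix T :: real and z assume z: "0 < T" "continuous_on {0..T} z" "z 0 = 0" "z T = (x, y)"
    define z' where "z' t = (if t \<le> - T then 0 else z (t + T))" for t
    \<comment> \<open>At the junction \<open>- T\<close> both branches are 0 because
      \<open>z 0 = 0\<close>.\<close>
    have "continuous_on ({..- T} \<union> {- T..0}) z'"
      unfolding z'_def
      by (rule continuous_on_If)
        (use z in \<open>auto intro!: continuous_on_compose2[OF z(2)] continuous_intros\<close>)
    moreover have "{..- T} \<union> {- T..0} = {..0}" using z(1) by auto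
    ultimately have "continuous_on {..0} z'" by simp
    moreover have "z' 0 = (x, y)" using z by (simp add: z'_def)
    moreover have ev: "\<forall>\<^sub>F t in at_bot. z' t = 0"
      using eventually_le_at_bot[of "- T"] by eventually_elim (simp add: z'_def)
    have "\<forall>\<^sub>F t in at_bot. z' t \<in> range R"
      using ev by eventually_elim (metis R.zero rangeI)
    moreover have "\<forall>\<^sub>F t in at_bot. norm (pseudo_inverse R (z' t)) = 0"
      using ev by eventually_elim (simp add: pseudo_inverse_0)
    then have "((\<lambda>t. norm (pseudo_inverse R (z' t))) \<longlongrightarrow> 0) at_bot"
      by (rule tendsto_eventually)
    ultimately have "(INF z \<in> ?Z. ?I z) \<le> ?I z'"
      by (intro INF_lower) simp
    also have "\<dots> \<le> rate S \<iota> Q DF \<mu> 0 T z"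
      unfolding z'_def by (rule rate_minus_infinity_extend_by_zero) (use z in simp_all)
    finally show "(INF z \<in> ?Z. ?I z) \<le> rate S \<iota> Q DF \<mu> 0 T z" .
  qed
qed

end

theorem theorem3p1:
  fixes \<Omega> :: "'a::euclidean_space set"
    and J :: "'h::{real_inner,banach,second_countable_topology} \<Rightarrow> 'a \<Rightarrow> real"
    and e :: "nat \<Rightarrow> 'h"
    and \<alpha> q :: "nat \<Rightarrow> real"
    and \<iota> :: "'h \<Rightarrow> 'g::{real_inner,banach,second_countable_topology}"
    and Q DF :: "'h \<Rightarrow> 'h"
    and F :: "'h \<Rightarrow> real"
    and \<kappa> \<mu> :: real
    and S :: "real \<Rightarrow> 'h \<times> 'g \<Rightarrow> 'h \<times> 'g"
    and x :: 'h and y :: 'g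
  assumes "bounded_domain \<Omega>" and "regular_boundary \<Omega>"
    and "L2_realization \<Omega> J"
    and "complete_orthonormal e"
    and "\<And>k. (e k, - \<alpha> k *\<^sub>R e k) \<in> dirichlet_laplacian \<Omega> J"
    and "0 < \<alpha> 0" and "\<And>k. \<alpha> k \<le> \<alpha> (Suc k)"
    and "is_completion \<Omega> J \<alpha> e (- 1) \<iota>"
    and "bounded_linear Q" and "\<And>k. Q (e k) = q k *\<^sub>R e k"
    and "summable (\<lambda>k. (q k)\<^sup>2 / \<alpha> k)"
    and "\<And>u. GDERIV F u :> DF u" and "continuous_on UNIV DF"
    and "F 0 = 0" and "\<And>u. 0 \<le> F u" and "\<And>u. 0 \<le> DF u \<bullet> u"
    and "0 \<le> \<kappa>" and "\<And>u v. norm (DF u - DF v) \<le> \<kappa> * norm (u - v)"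
    and "0 < \<mu>"
    and "C0_semigroup S" and "generator S = A_mu \<alpha> e \<iota> \<mu>"
  shows "quasi_potential S \<iota> Q DF \<mu> x y =
    (INF z \<in> {z. continuous_on {..0} z \<and> z 0 = (x, y) \<and>
        (\<forall>\<^sub>F t in at_bot. z t \<in> range (op_sqrt (C_mu \<alpha> e \<iota> q \<mu>))) \<and>
        ((\<lambda>t. norm (pseudo_inverse (op_sqrt (C_mu \<alpha> e \<iota> q \<mu>)) (z t))) \<longlongrightarrow> 0) at_bot}.
      rate_minus_infinity S \<iota> Q DF \<mu> z)"
proof -
  interpret damped_wave_system e \<alpha> q \<iota> Q DF \<kappa> \<mu> S
  proof (rule damped_wave_system.intro)
    have completion: "linear \<iota>" "\<And>u. (norm (\<iota> u))\<^sup>2 = Hdelta_sqnorm \<alpha> e (- 1) u"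
      "closure (\<iota> ` {u. \<exists>\<phi> \<in> test_functions \<Omega>. AE x in lebesgue_on \<Omega>. J u x = \<phi> x}) = UNIV"
      using assms(8) by (simp_all only: is_completion_def)
    then show "linear \<iota>" "\<And>u. (norm (\<iota> u))\<^sup>2 = Hdelta_sqnorm \<alpha> e (- 1) u"
      by blast+
    \<comment> \<open>The image of the test functions alone is already dense, so the larger range is
      dense too.\<close>
    show "closure (range \<iota>) = UNIV"
      using completion(3) closure_mono[OF image_mono[OF subset_UNIV], of \<iota>] by blast
  qed (rule assms)+
  show ?thesis
    unfolding op_sqrt_C_mu by (rule quasi_potential_eq)
qed

end
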